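(* Let $1\leq p\leq 2$, let $A,B\subset\mathbb{R}^2$ be $L_p$-zonoids, and let $u\in\mathbb{S}^1$. Assume $|P_{u^\perp}A|>0$. Then $$\frac{|A\oplus_p B|}{|P_{u^\perp}(A\oplus_p B)|}\geq\frac{|A|}{|P_{u^\perp}A|}.$$
   Context: For a convex body $K\subset\mathbb{R}^2$, $h_K(x)=\max_{y\in K}\langle x,y\rangle$ denotes its support function. For $p\geq 1$ and convex bodies $K,L\subset\mathbb{R}^2$ containing the origin, the $L_p$-sum $K\oplus_p L$ is the convex body defined by $h_{K\oplus_p L}^p(x)=h_K^p(x)+h_L^p(x)$ for all $x\in\mathbb{R}^2$. An $L_p$-zonotope is a finite $L_p$-sum of origin-symmetric segments $[-v,v]$, and an $L_p$-zonoid is a limit of $L_p$-zonotopes in the Hausdorff metric. Convex bodies are compact convex sets and may have empty interior. $P_{u^\perp}$ is the orthogonal projection onto the line $u^\perp$; $|A|$ is the area of $A\subset\mathbb{R}^2$, and $|P_{u^\perp}A|$ is the length of the projection. *)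

theory Defs
  imports "HOL-Analysis.Analysis"
begin

definition convex_body :: "'a::euclidean_space set \<Rightarrow> bool" where
  "convex_body K \<longleftrightarrow> compact K \<and> convex K \<and> K \<noteq> {}"

definition support_fun :: "'a::euclidean_space set \<Rightarrow> 'a \<Rightarrow> real" where
  "support_fun K x = (SUP y\<in>K. x \<bullet> y)"

(* All bodies involved contain the origin, so the support functions are nonnegative and
   powr is the usual power (with 0 powr p = 0).  The description is proper: see lp_sum_ex1. *)
definition lp_sum :: "real \<Rightarrow> 'a::euclidean_space set \<Rightarrow> 'a set \<Rightarrow> 'a set" where
  "lp_sum p K L = (THE M. convex_body M \<and> 0 \<in> M \<and>
     (\<forall>x. support_fun M x powr p = support_fun K x powr p + support_fun L x powr p))"

inductive lp_zonotope :: "real \<Rightarrow> 'a::euclidean_space set \<Rightarrow> bool" for p where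
  segment: "lp_zonotope p (closed_segment (- v) v)"
| sum: "lp_zonotope p Z \<Longrightarrow> lp_zonotope p (lp_sum p Z (closed_segment (- v) v))"

definition hausdorff_dist :: "'a::metric_space set \<Rightarrow> 'a set \<Rightarrow> real" where
  "hausdorff_dist K L = max (SUP x\<in>K. infdist x L) (SUP y\<in>L. infdist y K)"

definition lp_zonoid :: "real \<Rightarrow> 'a::euclidean_space set \<Rightarrow> bool" where
  "lp_zonoid p K \<longleftrightarrow> convex_body K \<and>
     (\<exists>Z. (\<forall>n. lp_zonotope p (Z n)) \<and> (\<lambda>n. hausdorff_dist (Z n) K) \<longlonglongrightarrow> 0)"

(* Orthogonal projection onto the hyperplane orthogonal to a unit vector u. *)
definition proj_perp :: "'a::euclidean_space \<Rightarrow> 'a \<Rightarrow> 'a" where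
  "proj_perp u x = x - (x \<bullet> u) *\<^sub>R u"

definition rot90 :: "real^2 \<Rightarrow> real^2" where
  "rot90 u = vector [- (u $ 2), u $ 1]"

(* For a unit vector u, t \<mapsto> t *\<^sub>R rot90 u is an isometry of the reals onto the line orthogonal
   to u; the length of a subset of that line is the Lebesgue measure of its preimage. *)
definition perp_line_length :: "real^2 \<Rightarrow> (real^2) set \<Rightarrow> real" where
  "perp_line_length u S = measure lebesgue {t. t *\<^sub>R rot90 u \<in> S}"


lemma rot90_orthonormal:
  assumes "norm u = 1"
  shows "norm (rot90 u) = 1" "u \<bullet> rot90 u = 0"
proof -
  have "u \<bullet> u = 1"
    using assms by (simp add: norm_eq_1)
  then show "norm (rot90 u) = 1"
    by (simp add: rot90_def norm_eq_1 inner_vec_def sum_2)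
  show "u \<bullet> rot90 u = 0"
    by (simp add: rot90_def inner_vec_def sum_2)
qed

lemma perp_line_eq_range:
  assumes "norm u = 1"
  shows "range (\<lambda>t. t *\<^sub>R rot90 u) = {x. u \<bullet> x = 0}"
proof (intro equalityI subsetI)
  fix x assume "x \<in> range (\<lambda>t. t *\<^sub>R rot90 u)"
  then show "x \<in> {x. u \<bullet> x = 0}"
    using rot90_orthonormal[OF assms] by auto
next
  fix x assume "x \<in> {x. u \<bullet> x = 0}"
  then have x: "u $ 1 * x $ 1 + u $ 2 * x $ 2 = 0"
    by (simp add: inner_vec_def sum_2)
  have u: "u $ 1 * u $ 1 + u $ 2 * u $ 2 = 1"
    using assms by (simp add: norm_eq_1 inner_vec_def sum_2)
  have "x $ 1 = (u $ 1 * x $ 2 - u $ 2 * x $ 1) * - (u $ 2)"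
       "x $ 2 = (u $ 1 * x $ 2 - u $ 2 * x $ 1) * u $ 1"
    using x u by algebra+
  then have "x = (u $ 1 * x $ 2 - u $ 2 * x $ 1) *\<^sub>R rot90 u"
    unfolding vec_eq_iff forall_2 rot90_def by simp
  then show "x \<in> range (\<lambda>t. t *\<^sub>R rot90 u)"
    by blast
qed

lemma support_fun_upper:
  assumes "convex_body K" "y \<in> K"
  shows "x \<bullet> y \<le> support_fun K x"
proof -
  have "bounded ((\<bullet>) x ` K)"
    using assms(1) unfolding convex_body_def
    by (intro compact_imp_bounded compact_continuous_image continuous_intros) auto
  then show ?thesis
    unfolding support_fun_def using assms(2) by (intro cSUP_upper bounded_imp_bdd_above)
qed

lemma support_fun_attained:
  assumes "convex_body K"
  obtains y where "y \<in> K" "support_fun K x = x \<bullet> y"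
proof -
  have "\<exists>y\<in>K. \<forall>z\<in>K. x \<bullet> z \<le> x \<bullet> y"
    using assms unfolding convex_body_def
    by (intro continuous_attains_sup continuous_intros) auto
  then obtain y where y: "y \<in> K" "\<And>z. z \<in> K \<Longrightarrow> x \<bullet> z \<le> x \<bullet> y"
    by blast
  then have "support_fun K x \<le> x \<bullet> y"
    unfolding support_fun_def by (intro cSUP_least) auto
  with y(1) support_fun_upper[OF assms y(1), of x] that show ?thesis
    by fastforce
qed

lemma support_fun_nonneg:
  assumes "convex_body K" "0 \<in> K"
  shows "0 \<le> support_fun K x"
  using support_fun_upper[OF assms, of x] by simp

lemma support_fun_le_imp_subset:
  assumes K: "convex_body K" and L: "convex_body L"
    and le: "\<And>x. support_fun K x \<le> support_fun L x"
  shows "K \<subseteq> L"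
proof
  fix z assume z: "z \<in> K"
  show "z \<in> L"
  proof (rule ccontr)
    assume "z \<notin> L"
    then obtain a b where ab: "a \<bullet> z < b" "\<forall>x\<in>L. b < a \<bullet> x"
      using separating_hyperplane_closed_point[of L z] L
      by (auto simp: convex_body_def compact_imp_closed)
    obtain y where y: "y \<in> L" "support_fun L (- a) = (- a) \<bullet> y"
      using support_fun_attained[OF L] by blast
    have "(- a) \<bullet> z \<le> (- a) \<bullet> y"
      using support_fun_upper[OF K z, of "- a"] le[of "- a"] y(2) by linarith
    with ab y(1) show False by force
  qed
qed

lemma young_aux:
  fixes x y p :: real
  assumes "p \<ge> 1" "x \<ge> 0" "y \<ge> 0"
  shows "x powr (p - 1) * y \<le> (1 - 1 / p) * x powr p + (1 / p) * y powr p"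
proof (cases "x = 0 \<or> y = 0")
  case False
  with assms have "x > 0" "y > 0" by auto
  have "(x powr p) powr (1 - 1 / p) * (y powr p) powr (1 / p)
      \<le> (1 - 1 / p) * x powr p + (1 / p) * y powr p"
    using assms \<open>x > 0\<close> \<open>y > 0\<close> by (intro Youngs_inequality_0) auto
  moreover have "p * (1 - 1 / p) = p - 1" "p * (1 / p) = 1"
    using assms by (auto simp: field_simps)
  ultimately show ?thesis
    using assms by (simp add: powr_powr)
qed (use assms in auto)

definition lp_coeffs :: "real \<Rightarrow> (real \<times> real) set" where
  "lp_coeffs p = {(a, b). 0 \<le> a \<and> 0 \<le> b \<and>
     (\<forall>s\<ge>0. \<forall>t\<ge>0. a * s + b * t \<le> (s powr p + t powr p) powr (1 / p))}"

lemma lp_coeffs_compact: "compact (lp_coeffs p)"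
proof -
  have "lp_coeffs p = {c. 0 \<le> fst c} \<inter> {c. 0 \<le> snd c} \<inter>
      (\<Inter>s\<in>{0..}. \<Inter>t\<in>{0..}. {c. fst c * s + snd c * t \<le> (s powr p + t powr p) powr (1 / p)})"
    by (auto simp: lp_coeffs_def)
  also have "closed \<dots>"
    by (intro closed_Int closed_INT ballI closed_Collect_le continuous_intros)
  finally have cl: "closed (lp_coeffs p)" .
  have "a \<le> 1 \<and> b \<le> 1" if "(a, b) \<in> lp_coeffs p" for a b
  proof -
    have *: "a * s + b * t \<le> (s powr p + t powr p) powr (1 / p)" if "s \<ge> 0" "t \<ge> 0" for s t
      using \<open>(a, b) \<in> lp_coeffs p\<close> that by (auto simp: lp_coeffs_def)
    show ?thesis
      using *[of 1 0] *[of 0 1] by simp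
  qed
  then have "lp_coeffs p \<subseteq> {0..1} \<times> {0..1}"
    by (auto simp: lp_coeffs_def)
  then have "bounded (lp_coeffs p)"
    by (rule bounded_subset[rotated]) (intro bounded_Times bounded_closed_interval)
  with cl show ?thesis
    by (simp add: compact_eq_bounded_closed)
qed

lemma lp_coeffs_convex:
  assumes "(a, b) \<in> lp_coeffs p" "(a', b') \<in> lp_coeffs p" "u \<ge> 0" "v \<ge> 0" "u + v = 1"
  shows "(u * a + v * a', u * b + v * b') \<in> lp_coeffs p"
proof -
  have "(u * a + v * a') * s + (u * b + v * b') * t \<le> (s powr p + t powr p) powr (1 / p)"
    (is "_ \<le> ?R") if "s \<ge> 0" "t \<ge> 0" for s t
  proof -
    have "(u * a + v * a') * s + (u * b + v * b') * t
        = u * (a * s + b * t) + v * (a' * s + b' * t)"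
      by (simp add: algebra_simps)
    also have "\<dots> \<le> u * ?R + v * ?R"
      using assms that by (intro add_mono mult_left_mono) (auto simp: lp_coeffs_def)
    also have "\<dots> = ?R"
      using assms(5) by (simp flip: distrib_right)
    finally show ?thesis .
  qed
  with assms show ?thesis
    by (auto simp: lp_coeffs_def)
qed

lemma lp_coeffs_attained:
  assumes p: "p \<ge> 1" and S: "S \<ge> 0" and T: "T \<ge> 0"
  obtains a b where "(a, b) \<in> lp_coeffs p" "a * S + b * T = (S powr p + T powr p) powr (1 / p)"
proof (cases "S = 0 \<and> T = 0")
  case True
  have "(0, 0) \<in> lp_coeffs p" by (simp add: lp_coeffs_def)
  with True that[of 0 0] show ?thesis by simp
next
  case False
  have norm1: "(X / N) powr p + (Y / N) powr p = 1" and Npos: "N > 0"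
    if "X \<ge> 0" "Y \<ge> 0" "\<not> (X = 0 \<and> Y = 0)" "N = (X powr p + Y powr p) powr (1 / p)" for X Y N
  proof -
    have "X powr p > 0 \<or> Y powr p > 0"
      using that by auto
    then have pos: "X powr p + Y powr p > 0"
      by (smt (verit) powr_ge_zero)
    then show "N > 0"
      using that(4) by simp
    have Np: "N powr p = X powr p + Y powr p"
      using that(4) p pos by (simp add: powr_powr)
    have "(X / N) powr p + (Y / N) powr p = (X powr p + Y powr p) / N powr p"
      using that \<open>N > 0\<close> by (simp add: powr_divide add_divide_distrib)
    also have "\<dots> = 1"
      using Np pos by simp
    finally show "(X / N) powr p + (Y / N) powr p = 1" .
  qed
  define N where "N = (S powr p + T powr p) powr (1 / p)"
  have N: "N > 0" "(S / N) powr p + (T / N) powr p = 1"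
    using norm1[OF S T False N_def] Npos[OF S T False N_def] by auto
  define a b where "a = (S / N) powr (p - 1)" and "b = (T / N) powr (p - 1)"
  have mem: "a * s + b * t \<le> (s powr p + t powr p) powr (1 / p)" if st: "s \<ge> 0" "t \<ge> 0" for s t
  proof (cases "s = 0 \<and> t = 0")
    case False
    define n where "n = (s powr p + t powr p) powr (1 / p)"
    have n: "n > 0" "(s / n) powr p + (t / n) powr p = 1"
      using norm1[OF st False n_def] Npos[OF st False n_def] by auto
    have "a * (s / n) \<le> (1 - 1 / p) * (S / N) powr p + (1 / p) * (s / n) powr p"
      unfolding a_def using p S N n st by (intro young_aux) auto
    moreover have "b * (t / n) \<le> (1 - 1 / p) * (T / N) powr p + (1 / p) * (t / n) powr p"
      unfolding b_def using p T N n st by (intro young_aux) auto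
    ultimately have "a * (s / n) + b * (t / n)
        \<le> (1 - 1 / p) * ((S / N) powr p + (T / N) powr p)
          + (1 / p) * ((s / n) powr p + (t / n) powr p)"
      by (simp only: distrib_left)
    then have "(a * s + b * t) / n \<le> 1"
      using N(2) n(2) by (simp add: add_divide_distrib)
    then show ?thesis
      using n(1) by (simp add: n_def[symmetric] divide_le_eq)
  qed simp
  have "(a, b) \<in> lp_coeffs p"
    using mem by (simp add: lp_coeffs_def a_def b_def)
  moreover have "a * S + b * T = N"
  proof -
    have "X powr (p - 1) * X = X powr p" if "X \<ge> 0" for X :: real
      using that powr_mult_base[of X "p - 1"] by (simp add: mult.commute)
    then have "a * (S / N) = (S / N) powr p" "b * (T / N) = (T / N) powr p"
      unfolding a_def b_def using N(1) S T by (meson divide_nonneg_pos)+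
    then have "a * (S / N) + b * (T / N) = 1"
      using N(2) by simp
    then show ?thesis
      using N(1) by (simp add: field_simps)
  qed
  ultimately show ?thesis
    using that N_def by blast
qed

lemma convex_cone_add:
  assumes "convex K" "x \<in> K" "y \<in> K" "c \<ge> (0::real)" "d \<ge> 0"
  obtains z where "z \<in> K" "c *\<^sub>R x + d *\<^sub>R y = (c + d) *\<^sub>R z"
proof (cases "c + d = 0")
  case True
  with assms that[of x] show ?thesis by (auto simp: add_nonneg_eq_0_iff)
next
  case False
  then have pos: "c + d > 0" using assms by linarith
  have "(c / (c + d)) *\<^sub>R x + (d / (c + d)) *\<^sub>R y \<in> K"
    using assms pos by (intro convexD) (auto simp flip: add_divide_distrib)
  then show ?thesis
    by (rule that) (use False in \<open>simp add: scaleR_add_right\<close>)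
qed

lemma lp_sum_exists:
  fixes K L :: "'a::euclidean_space set"
  assumes p: "p \<ge> 1" and K: "convex_body K" "0 \<in> K" and L: "convex_body L" "0 \<in> L"
  obtains M where "convex_body M" "0 \<in> M"
    "\<And>x. support_fun M x = (support_fun K x powr p + support_fun L x powr p) powr (1 / p)"
proof -
  define M where "M = (\<lambda>(c, k, l). fst c *\<^sub>R k + snd c *\<^sub>R l) ` (lp_coeffs p \<times> K \<times> L)"
  have M_iff: "z \<in> M \<longleftrightarrow> (\<exists>a b k l. (a, b) \<in> lp_coeffs p \<and> k \<in> K \<and> l \<in> L \<and> z = a *\<^sub>R k + b *\<^sub>R l)"
    for z
    by (force simp: M_def)
  have "compact M"
    unfolding M_def case_prod_beta using K L
    by (intro compact_continuous_image compact_Times lp_coeffs_compact continuous_intros)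
       (auto simp: convex_body_def)
  moreover have "convex M"
  proof (rule convexI)
    fix y z u v assume "y \<in> M" "z \<in> M" and uv: "0 \<le> u" "0 \<le> v" "u + v = (1::real)"
    then obtain a b k l a' b' k' l' where
      1: "(a, b) \<in> lp_coeffs p" "k \<in> K" "l \<in> L" "y = a *\<^sub>R k + b *\<^sub>R l" and
      2: "(a', b') \<in> lp_coeffs p" "k' \<in> K" "l' \<in> L" "z = a' *\<^sub>R k' + b' *\<^sub>R l'"
      unfolding M_iff by blast
    have nn: "0 \<le> u * a" "0 \<le> v * a'" "0 \<le> u * b" "0 \<le> v * b'"
      using 1(1) 2(1) uv by (auto simp: lp_coeffs_def)
    obtain k'' where k: "k'' \<in> K" "(u * a) *\<^sub>R k + (v * a') *\<^sub>R k' = (u * a + v * a') *\<^sub>R k''"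
      using convex_cone_add[of K k k'] K 1 2 nn by (auto simp: convex_body_def)
    obtain l'' where l: "l'' \<in> L" "(u * b) *\<^sub>R l + (v * b') *\<^sub>R l' = (u * b + v * b') *\<^sub>R l''"
      using convex_cone_add[of L l l'] L 1 2 nn by (auto simp: convex_body_def)
    have "u *\<^sub>R y + v *\<^sub>R z
        = ((u * a) *\<^sub>R k + (v * a') *\<^sub>R k') + ((u * b) *\<^sub>R l + (v * b') *\<^sub>R l')"
      using 1 2 by (simp add: scaleR_add_right)
    then have "u *\<^sub>R y + v *\<^sub>R z = (u * a + v * a') *\<^sub>R k'' + (u * b + v * b') *\<^sub>R l''"
      using k l by simp
    with k l lp_coeffs_convex[OF 1(1) 2(1) uv] show "u *\<^sub>R y + v *\<^sub>R z \<in> M"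
      unfolding M_iff by blast
  qed
  moreover have "0 \<in> M"
    unfolding M_iff using K L
    by (intro exI[of _ 0] conjI) (auto simp: lp_coeffs_def)
  ultimately have M: "convex_body M" "0 \<in> M"
    by (auto simp: convex_body_def)
  have "support_fun M x = (support_fun K x powr p + support_fun L x powr p) powr (1 / p)" for x
  proof (rule antisym)
    obtain z where z: "z \<in> M" "support_fun M x = x \<bullet> z"
      using support_fun_attained[OF M(1)] by blast
    then obtain a b k l where
      1: "(a, b) \<in> lp_coeffs p" "k \<in> K" "l \<in> L" "z = a *\<^sub>R k + b *\<^sub>R l"
      unfolding M_iff by blast
    have "x \<bullet> z = a * (x \<bullet> k) + b * (x \<bullet> l)"
      using 1 by (simp add: inner_add_right)
    also have "\<dots> \<le> a * support_fun K x + b * support_fun L x"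
      using 1 K L by (intro add_mono mult_left_mono support_fun_upper) (auto simp: lp_coeffs_def)
    also have "\<dots> \<le> (support_fun K x powr p + support_fun L x powr p) powr (1 / p)"
      using 1(1) support_fun_nonneg[OF K] support_fun_nonneg[OF L] by (auto simp: lp_coeffs_def)
    finally show "support_fun M x \<le> (support_fun K x powr p + support_fun L x powr p) powr (1 / p)"
      using z by simp
  next
    obtain a b where ab: "(a, b) \<in> lp_coeffs p"
      "a * support_fun K x + b * support_fun L x
         = (support_fun K x powr p + support_fun L x powr p) powr (1 / p)"
      using lp_coeffs_attained[OF p support_fun_nonneg[OF K] support_fun_nonneg[OF L]] by blast
    obtain k where k: "k \<in> K" "support_fun K x = x \<bullet> k"
      using support_fun_attained[OF K(1)] by blast
    obtain l where l: "l \<in> L" "support_fun L x = x \<bullet> l"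
      using support_fun_attained[OF L(1)] by blast
    have "a *\<^sub>R k + b *\<^sub>R l \<in> M"
      unfolding M_iff using ab k l by blast
    from support_fun_upper[OF M(1) this, of x]
    show "(support_fun K x powr p + support_fun L x powr p) powr (1 / p) \<le> support_fun M x"
      using ab(2) k(2) l(2) by (simp add: inner_add_right)
  qed
  with M that show ?thesis by blast
qed

lemma lp_sum_ex1:
  fixes K L :: "'a::euclidean_space set"
  assumes p: "p \<ge> 1" and K: "convex_body K" "0 \<in> K" and L: "convex_body L" "0 \<in> L"
  shows "\<exists>!M. convex_body M \<and> 0 \<in> M \<and>
     (\<forall>x. support_fun M x powr p = support_fun K x powr p + support_fun L x powr p)"
proof -
  obtain M where M: "convex_body M" "0 \<in> M"
    "\<And>x. support_fun M x = (support_fun K x powr p + support_fun L x powr p) powr (1 / p)"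
    using lp_sum_exists[OF assms] by blast
  show ?thesis
  proof (intro ex1I[of _ M] conjI allI M)
    show "support_fun M x powr p = support_fun K x powr p + support_fun L x powr p" for x
      using p by (simp add: M(3) powr_powr)
  next
    fix M' assume M': "convex_body M' \<and> 0 \<in> M' \<and>
      (\<forall>x. support_fun M' x powr p = support_fun K x powr p + support_fun L x powr p)"
    have "support_fun M' x = support_fun M x" for x
    proof -
      have "support_fun M' x = (support_fun M' x powr p) powr (1 / p)"
        using p support_fun_nonneg[of M' x] M'[THEN conjunct1] M'[THEN conjunct2, THEN conjunct1]
        by (simp add: powr_powr)
      then show ?thesis using M' M(3) by metis
    qed
    then show "M' = M"
      using M' M by (intro equalityI support_fun_le_imp_subset) auto
  qed
qed

lemma lp_sum_props:
  fixes K L :: "'a::euclidean_space set"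
  assumes "p \<ge> 1" "convex_body K" "0 \<in> K" "convex_body L" "0 \<in> L"
  shows "convex_body (lp_sum p K L)" "0 \<in> lp_sum p K L"
    "support_fun (lp_sum p K L) x powr p = support_fun K x powr p + support_fun L x powr p"
  using theI'[OF lp_sum_ex1[OF assms]] unfolding lp_sum_def by auto

lemma lp_zonotope_convex_body:
  assumes "lp_zonotope p Z" "p \<ge> 1"
  shows "convex_body Z \<and> 0 \<in> Z"
  using assms(1)
proof induction
  have seg: "convex_body (closed_segment (- v) v)" "0 \<in> closed_segment (- v) v" for v :: 'a
    using midpoint_in_closed_segment[of "- v" v] by (auto simp: convex_body_def midpoint_def)
  {
    case (segment v)
    then show ?case using seg by blast
  next
    case (sum Z v)
    then show ?case using lp_sum_props(1,2)[OF assms(2)] seg by blast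
  }
qed

lemma infdist_le_hausdorff_dist:
  assumes "compact K" "x \<in> K"
  shows "infdist x L \<le> hausdorff_dist K L"
proof -
  have "bounded ((\<lambda>x. infdist x L) ` K)"
    using assms(1) by (intro compact_imp_bounded compact_continuous_image continuous_intros)
  then have "infdist x L \<le> (SUP x\<in>K. infdist x L)"
    using assms(2) by (intro cSUP_upper bounded_imp_bdd_above)
  then show ?thesis
    by (simp add: hausdorff_dist_def)
qed

lemma lp_zonoid_convex_body:
  assumes "lp_zonoid p K" "p \<ge> 1"
  shows "convex_body K" "0 \<in> K"
proof -
  show K: "convex_body K"
    using assms by (simp add: lp_zonoid_def)
  obtain Z where Z: "\<And>n. lp_zonotope p (Z n)" "(\<lambda>n. hausdorff_dist (Z n) K) \<longlonglongrightarrow> 0"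
    using assms(1) unfolding lp_zonoid_def by blast
  have "infdist 0 K \<le> hausdorff_dist (Z n) K" for n
    using lp_zonotope_convex_body[OF Z(1) assms(2)]
    by (auto simp: convex_body_def intro: infdist_le_hausdorff_dist)
  then have "infdist 0 K \<le> 0"
    using LIMSEQ_le_const[OF Z(2)] by blast
  with K show "0 \<in> K"
    using in_closed_iff_infdist_zero[of K 0] infdist_nonneg[of 0 K]
    by (auto simp: convex_body_def compact_imp_closed)
qed

end

theory Submission
  imports Defs
begin

text \<open>
Zonoids are symmetric, so for \<open>w = rot90 u\<close> the projections have length twice the support
function at \<open>w\<close>, and the claim is that \<open>|A| / h\<^sub>A(w)\<close> does not decrease when \<open>B\<close> is added to \<open>A\<close>. By
approximation \<open>A\<close> and \<open>B\<close> may be taken to be zonotopes (\<open>lp_zonoid_ratio_mono\<close>), and by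
associativity \<open>B\<close> may be taken to be one segment \<open>[- v, v]\<close>. If \<open>v\<close> is orthogonal to \<open>w\<close>, then
\<open>h\<^sub>A(w)\<close> stays the same and the area does not decrease.

Otherwise \<open>h\<^sub>A(w)\<close> grows by the factor \<open>\<kappa> = (1 + (\<bar>w \<bullet> v\<bar> / h\<^sub>A(w))\<^sup>p)\<^sup>1\<^sup>/\<^sup>p\<close>. The area grows at least by
this factor because every chord of \<open>A\<close> parallel to \<open>v\<close> does (\<open>lp_zonotope_chord_growth\<close>), and area is
the integral of chord lengths (\<open>area_mono_chords\<close>).

For chords, \<open>p = 1\<close> is immediate. For \<open>1 < p \<le> 2\<close> let \<open>q \<ge> 2\<close> be the conjugate exponent. A zonotope
generated by \<open>v\<^sub>1, ..., v\<^sub>n\<close> is the image of the unit ball of \<open>\<ell>\<^sub>q\<close> under \<open>l \<mapsto> \<Sum>\<^sub>i l\<^sub>i v\<^sub>i\<close>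
(\<open>lp_zonotope_coordinates\<close>, \<open>combination_in_lp_sum_segment\<close>). Let unit vectors \<open>l\<close> and \<open>m\<close> represent
one endpoint and the negative of the other endpoint of a chord, and let \<open>s = (l + m) / 2\<close>, which
represents half the chord. Moving \<open>l\<close> and \<open>m\<close> slightly along \<open>- s\<close> shortens the chord but makes room
in the unit ball for a coordinate along a small multiple of \<open>v\<close>. With optimal
proportions, the net gain to first order is a multiple of \<open>a\<^sup>p\<^sup>-\<^sup>1 + b\<^sup>p\<^sup>-\<^sup>1\<close>, where \<open>a\<close> and \<open>b\<close> are the
pairings of \<open>s\<close> with the norming functionals of \<open>l\<close> and \<open>m\<close> (\<open>perturbation_gain\<close>). So the desired
rate follows from \<open>a\<^sup>p\<^sup>-\<^sup>1 + b\<^sup>p\<^sup>-\<^sup>1 \<ge> 2 \<parallel>s\<parallel>\<^sup>p\<close> (\<open>dual_pairings_ge_midpoint\<close>) and Hoelder's inequality,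
which bounds \<open>\<parallel>s\<parallel>\<close> below by half the chord over \<open>h\<^sub>A(w)\<close>. The inequality for \<open>a\<close> and \<open>b\<close> is the sum
over coordinates of a scalar inequality with a free weight (\<open>clarkson_weighted\<close>); it uses \<open>q \<ge> 2\<close>, that
is, \<open>p \<le> 2\<close>. A Dini derivative argument turns the first order statement into the growth of chords
by \<open>\<kappa>\<close>.
\<close>

section \<open>Signed powers and a weighted Clarkson inequality\<close>

text \<open>The derivative of \<open>\<bar>x\<bar> powr q / q\<close> is \<open>spow (q - 1) x\<close>; it carries unit vectors of
\<open>\<ell>\<^sub>q\<close> to their norming functionals in \<open>\<ell>\<^sub>p\<close>.\<close>

definition spow :: "real \<Rightarrow> real \<Rightarrow> real" where
  "spow s x = sgn x * \<bar>x\<bar> powr s"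

lemma spow_minus [simp]: "spow s (- x) = - spow s x"
  by (simp add: spow_def sgn_minus)

lemma spow_nonneg: "0 \<le> x \<Longrightarrow> spow s x = x powr s"
  by (cases "x = 0") (simp_all add: spow_def)

lemma mult_spow: "x * spow (q - 1) x = \<bar>x\<bar> powr q"
proof -
  have "x * spow (q - 1) x = \<bar>x\<bar> * \<bar>x\<bar> powr (q - 1)"
    by (simp add: spow_def abs_real_def sgn_real_def)
  then show ?thesis
    by (simp add: powr_mult_base)
qed

lemma continuous_spow:
  assumes "s > 0"
  shows "continuous_on UNIV (spow s)"
proof -
  have "spow s = (\<lambda>x. max x 0 powr s - max (- x) 0 powr s)"
    by (auto simp: spow_def fun_eq_iff sgn_real_def max_def)
  moreover have "continuous_on UNIV (\<lambda>x. max x 0 powr s - max (- x) 0 powr s)"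
    using assms by (intro continuous_intros continuous_on_powr') auto
  ultimately show ?thesis by simp
qed

text \<open>Convexity of \<open>\<bar>x\<bar> powr q\<close> as a tangent line inequality. It replaces differentiation throughout.\<close>

lemma abs_powr_tangent:
  assumes "q \<ge> 1"
  shows "\<bar>x\<bar> powr q + q * spow (q - 1) x * (y - x) \<le> \<bar>y\<bar> powr q"
proof -
  have "spow (q - 1) x * y \<le> \<bar>spow (q - 1) x * y\<bar>"
    by simp
  also have "\<dots> \<le> \<bar>x\<bar> powr (q - 1) * \<bar>y\<bar>"
    by (simp add: spow_def abs_mult sgn_real_def)
  also have "\<dots> \<le> (1 - 1 / q) * \<bar>x\<bar> powr q + (1 / q) * \<bar>y\<bar> powr q"
    using assms by (intro young_aux) auto
  finally have "q * (spow (q - 1) x * y) \<le> q * ((1 - 1 / q) * \<bar>x\<bar> powr q + (1 / q) * \<bar>y\<bar> powr q)"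
    using assms by (intro mult_left_mono) auto
  also have "\<dots> = (q - 1) * \<bar>x\<bar> powr q + \<bar>y\<bar> powr q"
    using assms by (simp add: algebra_simps)
  finally have "q * (spow (q - 1) x * y) \<le> (q - 1) * (x * spow (q - 1) x) + \<bar>y\<bar> powr q"
    by (simp add: mult_spow)
  then show ?thesis
    unfolding mult_spow[symmetric, of x] by (simp add: algebra_simps)
qed

lemma powr_superadditive:
  fixes x y s :: real
  assumes "s \<ge> 1" "x \<ge> 0" "y \<ge> 0"
  shows "x powr s + y powr s \<le> (x + y) powr s"
proof -
  have *: "z powr s = z * z powr (s - 1)" if "z \<ge> 0" for z :: real
    using that powr_mult_base[of z "s - 1"] by simp
  have "x powr s + y powr s \<le> x * (x + y) powr (s - 1) + y * (x + y) powr (s - 1)"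
    unfolding *[OF assms(2)] *[OF assms(3)] using assms
    by (intro add_mono mult_left_mono powr_mono2) auto
  also have "\<dots> = (x + y) powr s"
    using assms *[of "x + y"] by (simp add: distrib_right)
  finally show ?thesis .
qed

text \<open>Convexity of \<open>x powr (q - 1)\<close>, applied to \<open>l + m = \<alpha> (l / \<alpha>) + (1 - \<alpha>) (m / (1 - \<alpha>))\<close>.\<close>

lemma powr_sum_le_weighted:
  fixes l m \<alpha> q :: real
  assumes "q \<ge> 2" "0 < \<alpha>" "\<alpha> < 1" "0 \<le> l" "0 \<le> m"
  shows "(l + m) powr (q - 1)
    \<le> \<alpha> powr (2 - q) * l powr (q - 1) + (1 - \<alpha>) powr (2 - q) * m powr (q - 1)"
proof -
  define T where "T = l + m"
  have tan: "T powr (q - 1) + (q - 1) * spow (q - 2) T * (z / \<beta> - T) \<le> z powr (q - 1) / \<beta> powr (q - 1)"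
    if "0 \<le> z" "0 < \<beta>" for z \<beta>
    using abs_powr_tangent[of "q - 1" T "z / \<beta>"] assms that
    by (simp add: T_def powr_divide)
  have w: "\<beta> * (z powr (q - 1) / \<beta> powr (q - 1)) = \<beta> powr (2 - q) * z powr (q - 1)"
    if "0 < \<beta>" for z \<beta> :: real
  proof -
    have "\<beta> powr (2 - q) = \<beta> powr (1 - (q - 1))" by simp
    also have "\<dots> = \<beta> powr 1 / \<beta> powr (q - 1)" by (rule powr_diff)
    finally show ?thesis using that by simp
  qed
  define t where "t = (q - 1) * spow (q - 2) T"
  have "T powr (q - 1) = \<alpha> * (T powr (q - 1) + t * (l / \<alpha> - T))
      + (1 - \<alpha>) * (T powr (q - 1) + t * (m / (1 - \<alpha>) - T))"
  proof -
    have "\<alpha> * (l / \<alpha> - T) = l - \<alpha> * T" "(1 - \<alpha>) * (m / (1 - \<alpha>) - T) = m - (1 - \<alpha>) * T"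
      using assms by (simp_all add: right_diff_distrib)
    then have "t * (\<alpha> * (l / \<alpha> - T)) + t * ((1 - \<alpha>) * (m / (1 - \<alpha>) - T)) = 0"
      by (simp only:) (simp add: T_def algebra_simps)
    moreover have "\<alpha> * (X + t * Y) + (1 - \<alpha>) * (X + t * Z) = X + (t * (\<alpha> * Y) + t * ((1 - \<alpha>) * Z))"
      for X Y Z :: real
      by (simp add: algebra_simps)
    ultimately show ?thesis by simp
  qed
  also have "\<dots> \<le> \<alpha> * (l powr (q - 1) / \<alpha> powr (q - 1))
      + (1 - \<alpha>) * (m powr (q - 1) / (1 - \<alpha>) powr (q - 1))"
    unfolding t_def using assms tan by (intro add_mono mult_left_mono) auto
  finally show ?thesis
    using assms by (simp only: w T_def)
qed

text \<open>By the trapezoidal rule for the convex function \<open>x powr (q - 1)\<close> the left side is at most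
\<open>(m - l) * (m powr (q - 1) + l powr (q - 1))\<close>, and this is at most the right side because
\<open>q \<ge> 2\<close>. The proof compares derivatives in \<open>m\<close>, which gives both steps at once.\<close>

lemma powr_trapezoid:
  fixes l m q :: real
  assumes q: "q \<ge> 2" and lm: "0 \<le> l" "l \<le> m"
  shows "2 / q * (m powr q - l powr q) \<le> (l + m) * (m powr (q - 1) - l powr (q - 1))"
proof -
  define F where "F x = (l + x) * (x powr (q - 1) - l powr (q - 1)) - 2 / q * (x powr q - l powr q)" for x
  have "F l \<le> F m"
  proof (rule DERIV_nonneg_imp_increasing_open[OF lm(2)])
    fix x assume x: "l < x" "x < m"
    then have "x > 0" using lm by simp
    have "(F has_real_derivative
        (l + x) * ((q - 1) * x powr (q - 1 - 1)) + (x powr (q - 1) - l powr (q - 1))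
          - 2 / q * (q * x powr (q - 1))) (at x)"
      unfolding F_def using \<open>x > 0\<close> q by (auto intro!: derivative_eq_intros)
    moreover have "(l + x) * ((q - 1) * x powr (q - 1 - 1)) + (x powr (q - 1) - l powr (q - 1))
          - 2 / q * (q * x powr (q - 1)) \<ge> 0"
    proof -
      have e: "x * x powr (q - 1 - 1) = x powr (q - 1)"
        using powr_mult_base[of x "q - 1 - 1"] \<open>x > 0\<close> by simp
      have "l powr (q - 1) = l * l powr (q - 1 - 1)"
        using powr_mult_base[of l "q - 1 - 1"] lm by simp
      also have "\<dots> \<le> l * x powr (q - 1 - 1)"
        using lm x q by (intro mult_left_mono powr_mono2) auto
      also have "\<dots> \<le> (q - 1) * (l * x powr (q - 1 - 1))"
        using mult_right_mono[of 1 "q - 1" "l * x powr (q - 1 - 1)"] lm q by simp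
      finally have 1: "l powr (q - 1) \<le> (q - 1) * (l * x powr (q - 1 - 1))" .
      have 2: "x powr (q - 1) \<le> (q - 1) * x powr (q - 1)"
        using mult_right_mono[of 1 "q - 1" "x powr (q - 1)"] q by simp
      have "(l + x) * ((q - 1) * x powr (q - 1 - 1))
          = (q - 1) * (l * x powr (q - 1 - 1)) + (q - 1) * (x * x powr (q - 1 - 1))"
        by (simp add: algebra_simps)
      moreover have "2 / q * (q * x powr (q - 1)) = 2 * x powr (q - 1)"
        using q by simp
      ultimately show ?thesis
        using 1 2 by (simp only: e)
    qed
    ultimately show "\<exists>y. (F has_real_derivative y) (at x) \<and> 0 \<le> y" by blast
  next
    show "continuous_on {l..m} F"
      unfolding F_def using lm q by (intro continuous_intros continuous_on_powr') auto
  qed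
  then show ?thesis by (simp add: F_def)
qed

text \<open>A weighted Clarkson inequality. Without its last summand it would be the convexity inequality
\<open>powr_sum_le_weighted\<close> when \<open>l\<close> and \<open>m\<close> have the same sign, but it would fail for opposite signs
when the weights \<open>d1\<close> and \<open>d2\<close> are very different. The correction vanishes after summation over
two sequences of equal \<open>\<ell>\<^sub>q\<close>-norm; the factor \<open>1 / q\<close> is forced by comparing first order terms at
\<open>m = - l\<close>.

Put \<open>D = d2 - d1 \<ge> 0\<close>. The right side is \<open>d1\<close> times the symmetric expression
\<open>(l + m) * (spow (q - 1) l + spow (q - 1) m)\<close> plus \<open>D\<close> times a quantity that is nonnegative by
convexity. For opposite signs the symmetric expression is already large enough, as \<open>d1 \<ge> 1\<close>. For
equal signs and \<open>\<bar>m\<bar> \<le> \<bar>l\<bar>\<close> the correction is nonnegative and convexity suffices. In the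
remaining case the two terms \<open>a \<le> b\<close> weighted by \<open>d1 \<le> d2\<close> are ordered by the trapezoidal
estimate, and Chebyshev's sum inequality reduces the claim to equal weights.\<close>

lemma clarkson_weighted_half:
  fixes l m \<alpha> q :: real
  assumes q: "q \<ge> 2" and \<alpha>: "1 / 2 \<le> \<alpha>" "\<alpha> < 1"
  defines "d1 \<equiv> \<alpha> powr (2 - q)" and "d2 \<equiv> (1 - \<alpha>) powr (2 - q)"
  shows "\<bar>l + m\<bar> powr q \<le> (l + m) * (d1 * spow (q - 1) l + d2 * spow (q - 1) m)
      + (d2 - d1) / q * (\<bar>l\<bar> powr q - \<bar>m\<bar> powr q)"
proof -
  have d: "1 \<le> d1" "d1 \<le> d2"
  proof -
    have "1 powr (2 - q) \<le> \<alpha> powr (2 - q)"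
      using \<alpha> q by (intro powr_mono2') auto
    then show "1 \<le> d1" by (simp add: d1_def)
    show "d1 \<le> d2"
      unfolding d1_def d2_def using \<alpha> q by (intro powr_mono2') auto
  qed
  have split: "(l + m) * (d1 * spow (q - 1) l + d2 * spow (q - 1) m)
      + (d2 - d1) / q * (\<bar>l\<bar> powr q - \<bar>m\<bar> powr q)
    = d1 * ((l + m) * (spow (q - 1) l + spow (q - 1) m))
      + (d2 - d1) * ((l + m) * spow (q - 1) m + (\<bar>l\<bar> powr q - \<bar>m\<bar> powr q) / q)" for l m :: real
    by (simp add: algebra_simps add_divide_distrib diff_divide_distrib)
  \<comment> \<open>The tangent at \<open>m\<close>, evaluated at \<open>- l\<close>.\<close>
  have B: "0 \<le> (l + m) * spow (q - 1) m + (\<bar>l\<bar> powr q - \<bar>m\<bar> powr q) / q" for l m :: real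
  proof -
    have "q * spow (q - 1) m * (- l - m) \<le> \<bar>l\<bar> powr q - \<bar>m\<bar> powr q"
      using abs_powr_tangent[of q m "- l"] q by simp
    then have "(q * spow (q - 1) m * (- l - m)) / q \<le> (\<bar>l\<bar> powr q - \<bar>m\<bar> powr q) / q"
      using q by (intro divide_right_mono) auto
    moreover have "(q * spow (q - 1) m * (- l - m)) / q = spow (q - 1) m * (- l - m)"
      using q by simp
    moreover have "spow (q - 1) m * (- l - m) = - ((l + m) * spow (q - 1) m)"
      by (simp add: algebra_simps)
    ultimately show ?thesis by linarith
  qed
  have opposite: "\<bar>x - y\<bar> powr q \<le> (x - y) * (spow (q - 1) x - spow (q - 1) y)"
    if "0 \<le> x" "0 \<le> y" for x y :: real
  proof -
    have ord: "\<bar>x - y\<bar> powr q \<le> (x - y) * (spow (q - 1) x - spow (q - 1) y)"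
      if "0 \<le> y" "y \<le> x" for x y :: real
    proof -
      have "(x - y) powr (q - 1) \<le> spow (q - 1) x - spow (q - 1) y"
        using powr_superadditive[of "q - 1" "x - y" y] that q by (simp add: spow_nonneg)
      then have "(x - y) * (x - y) powr (q - 1) \<le> (x - y) * (spow (q - 1) x - spow (q - 1) y)"
        using that by (intro mult_left_mono) auto
      then show ?thesis using that powr_mult_base[of "x - y" "q - 1"] by simp
    qed
    show ?thesis
    proof (cases "y \<le> x")
      case True then show ?thesis using ord that by blast
    next
      case False
      then have "\<bar>y - x\<bar> powr q \<le> (y - x) * (spow (q - 1) y - spow (q - 1) x)"
        using that by (intro ord) auto
      then show ?thesis by (simp add: abs_minus_commute algebra_simps)
    qed
  qed
  have same: "(l + m) powr q \<le> (l + m) * (d1 * l powr (q - 1) + d2 * m powr (q - 1))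
      + (d2 - d1) / q * (l powr q - m powr q)" if lm: "0 \<le> l" "0 \<le> m" for l m :: real
  proof (cases "m \<le> l")
    case True
    have T: "(l + m) powr q = (l + m) * (l + m) powr (q - 1)"
      using powr_mult_base[of "l + m" "q - 1"] lm by simp
    have "(l + m) * (l + m) powr (q - 1) \<le> (l + m) * (d1 * l powr (q - 1) + d2 * m powr (q - 1))"
      unfolding d1_def d2_def using lm \<alpha> q
      by (intro mult_left_mono powr_sum_le_weighted) auto
    moreover have "0 \<le> (d2 - d1) / q * (l powr q - m powr q)"
      using True lm q d by (intro mult_nonneg_nonneg) (auto intro: powr_mono2)
    ultimately show ?thesis unfolding T by linarith
  next
    case False
    define X where "X = (m powr q - l powr q) / q"
    define a where "a = (l + m) * l powr (q - 1) + X"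
    define b where "b = (l + m) * m powr (q - 1) - X"
    have "2 * X \<le> (l + m) * (m powr (q - 1) - l powr (q - 1))"
      using powr_trapezoid[of q l m] False lm q by (simp add: X_def)
    then have "a \<le> b"
      by (simp add: a_def b_def algebra_simps)
    have "2 powr (q - 1) \<le> d1 + d2"
      using powr_sum_le_weighted[of q \<alpha> 1 1] q \<alpha> by (simp add: d1_def d2_def)
    have "(l + m) powr (q - 1) \<le> 2 powr (q - 2) * (l powr (q - 1) + m powr (q - 1))"
    proof -
      have "(1 / 2) powr (2 - q) = 2 powr (q - 2)"
        using powr_minus_divide[of 2 "2 - q"] by (simp add: powr_divide)
      then show ?thesis
        using powr_sum_le_weighted[of q "1/2" l m] q lm by (simp add: distrib_left)
    qed
    then have "(l + m) * (l + m) powr (q - 1) \<le> (l + m) * (2 powr (q - 2) * (l powr (q - 1) + m powr (q - 1)))"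
      using lm by (intro mult_left_mono) auto
    then have "(l + m) powr q \<le> 2 powr (q - 2) * (a + b)"
      using powr_mult_base[of "l + m" "q - 1"] lm by (simp add: a_def b_def algebra_simps)
    also have "2 powr (q - 2) = 2 powr (q - 1) / 2"
      using powr_diff[of 2 "q - 1" 1] by simp
    also have "2 powr (q - 1) / 2 * (a + b) \<le> (d1 + d2) / 2 * (a + b)"
      using \<open>2 powr (q - 1) \<le> d1 + d2\<close> lm
      by (intro mult_right_mono divide_right_mono) (auto simp: a_def b_def)
    also have "\<dots> \<le> d1 * a + d2 * b"
      using mult_nonneg_nonneg[of "d2 - d1" "b - a"] d \<open>a \<le> b\<close> by (simp add: algebra_simps)
    also have "\<dots> = (l + m) * (d1 * l powr (q - 1) + d2 * m powr (q - 1)) - (d2 - d1) * X"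
      by (simp add: a_def b_def algebra_simps)
    also have "(d2 - d1) * X = (d2 - d1) / q * (m powr q - l powr q)"
      by (simp add: X_def)
    finally show ?thesis by (simp add: algebra_simps)
  qed
  have opp: "\<bar>l + m\<bar> powr q \<le> d1 * ((l + m) * (spow (q - 1) l + spow (q - 1) m))
      + (d2 - d1) * ((l + m) * spow (q - 1) m + (\<bar>l\<bar> powr q - \<bar>m\<bar> powr q) / q)"
    if "\<bar>l + m\<bar> powr q \<le> (l + m) * (spow (q - 1) l + spow (q - 1) m)"
  proof -
    have "\<bar>l + m\<bar> powr q \<le> d1 * \<bar>l + m\<bar> powr q"
      using d mult_right_mono[of 1 d1 "\<bar>l + m\<bar> powr q"] by simp
    also have "\<dots> \<le> d1 * ((l + m) * (spow (q - 1) l + spow (q - 1) m))"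
      using that d by (intro mult_left_mono) auto
    finally show ?thesis
      using mult_nonneg_nonneg[OF _ B[of l m], of "d2 - d1"] d by linarith
  qed
  consider "0 \<le> l" "0 \<le> m" | "l \<le> 0" "m \<le> 0" | "0 \<le> l" "m \<le> 0" | "l \<le> 0" "0 \<le> m"
    by linarith
  then show ?thesis
  proof cases
    case 1 then show ?thesis using same[of l m] by (simp add: spow_nonneg)
  next
    case 2
    have "spow (q - 1) l = - ((- l) powr (q - 1))" "spow (q - 1) m = - ((- m) powr (q - 1))"
      using 2 spow_nonneg[of "- l" "q - 1"] spow_nonneg[of "- m" "q - 1"] by simp_all
    moreover have "\<bar>l + m\<bar> = - l + - m" "\<bar>l\<bar> = - l" "\<bar>m\<bar> = - m"
      using 2 by auto
    ultimately show ?thesis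
      using same[of "- l" "- m"] 2 by (simp add: algebra_simps)
  next
    case 3
    then show ?thesis unfolding split using opposite[of l "- m"] by (intro opp) simp
  next
    case 4
    then show ?thesis unfolding split using opposite[of m "- l"] by (intro opp) (simp add: add.commute)
  qed
qed

lemma clarkson_weighted:
  fixes l m \<alpha> q :: real
  assumes q: "q \<ge> 2" and \<alpha>: "0 < \<alpha>" "\<alpha> < 1"
  defines "d1 \<equiv> \<alpha> powr (2 - q)" and "d2 \<equiv> (1 - \<alpha>) powr (2 - q)"
  shows "\<bar>l + m\<bar> powr q \<le> (l + m) * (d1 * spow (q - 1) l + d2 * spow (q - 1) m)
      + (d2 - d1) / q * (\<bar>l\<bar> powr q - \<bar>m\<bar> powr q)"
proof (cases "1 / 2 \<le> \<alpha>")
  case True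
  then show ?thesis
    unfolding d1_def d2_def using q \<alpha> by (intro clarkson_weighted_half)
next
  case False
  then show ?thesis
    using clarkson_weighted_half[of q "1 - \<alpha>" m l] q \<alpha>
    by (simp add: d1_def d2_def algebra_simps add_divide_distrib diff_divide_distrib)
qed

section \<open>Sequences in the unit sphere of \<open>\<ell>\<^sub>q\<close>\<close>

text \<open>Hoelder's inequality for finite sums.\<close>

lemma Holder_sum:
  fixes x y :: "'i \<Rightarrow> real"
  assumes pq: "p > 1" "q > 1" "1 / p + 1 / q = 1" and I: "finite I"
  shows "(\<Sum>i\<in>I. x i * y i)
    \<le> (\<Sum>i\<in>I. \<bar>x i\<bar> powr p) powr (1 / p) * (\<Sum>i\<in>I. \<bar>y i\<bar> powr q) powr (1 / q)"
proof (cases "(\<Sum>i\<in>I. \<bar>x i\<bar> powr p) = 0 \<or> (\<Sum>i\<in>I. \<bar>y i\<bar> powr q) = 0")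
  case True
  then have "(\<forall>i\<in>I. x i = 0) \<or> (\<forall>i\<in>I. y i = 0)"
    using I by (simp add: sum_nonneg_eq_0_iff)
  then show ?thesis by auto
next
  case False
  define N where "N = (\<Sum>i\<in>I. \<bar>x i\<bar> powr p) powr (1 / p)"
  define M where "M = (\<Sum>i\<in>I. \<bar>y i\<bar> powr q) powr (1 / q)"
  have pos: "(\<Sum>i\<in>I. \<bar>x i\<bar> powr p) > 0" "(\<Sum>i\<in>I. \<bar>y i\<bar> powr q) > 0"
    using False by (auto simp: less_le sum_nonneg)
  then have NM: "N > 0" "M > 0" "N powr p = (\<Sum>i\<in>I. \<bar>x i\<bar> powr p)"
      "M powr q = (\<Sum>i\<in>I. \<bar>y i\<bar> powr q)"
    using pq False by (auto simp: N_def M_def powr_powr)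
  have "(\<Sum>i\<in>I. x i * y i) / (N * M) = (\<Sum>i\<in>I. x i / N * (y i / M))"
    by (simp add: sum_divide_distrib)
  also have "\<dots> \<le> (\<Sum>i\<in>I. (\<bar>x i\<bar> / N) powr p / p + (\<bar>y i\<bar> / M) powr q / q)"
  proof (rule sum_mono)
    fix i
    have "x i / N * (y i / M) \<le> \<bar>x i\<bar> / N * (\<bar>y i\<bar> / M)"
      using abs_ge_self[of "x i / N * (y i / M)"] NM by (simp add: abs_mult)
    also have "\<dots> \<le> (\<bar>x i\<bar> / N) powr p / p + (\<bar>y i\<bar> / M) powr q / q"
      using pq NM by (intro Youngs_inequality) auto
    finally show "x i / N * (y i / M) \<le> (\<bar>x i\<bar> / N) powr p / p + (\<bar>y i\<bar> / M) powr q / q" .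
  qed
  also have "\<dots> = (\<Sum>i\<in>I. \<bar>x i\<bar> powr p) / N powr p / p + (\<Sum>i\<in>I. \<bar>y i\<bar> powr q) / M powr q / q"
    using NM(1,2) by (simp add: powr_divide sum.distrib flip: sum_divide_distrib)
  also have "\<dots> = 1"
    unfolding NM(3,4) using pos pq by simp
  finally show ?thesis
    using NM by (simp add: divide_le_eq flip: N_def M_def)
qed

text \<open>For positive \<open>A\<close> and \<open>B\<close> the minimum over \<open>\<alpha>\<close> of the right side of the hypothesis is attained at
\<open>\<alpha> = A powr (p - 1) / (A powr (p - 1) + B powr (p - 1))\<close>, and its \<open>(p - 1)\<close>-th power is the sum
\<open>A powr (p - 1) + B powr (p - 1)\<close>. If \<open>A\<close> or \<open>B\<close> vanishes, the optimal weight sits on the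
boundary and is reached as a limit.\<close>

lemma weighted_minimum_le:
  fixes A B C p q :: real
  assumes pq: "p > 1" "q \<ge> 2" "1 / p + 1 / q = 1" and AB: "A \<ge> 0" "B \<ge> 0" and C: "C \<ge> 0"
    and le: "\<And>\<alpha>. 0 < \<alpha> \<Longrightarrow> \<alpha> < 1 \<Longrightarrow> C \<le> \<alpha> powr (2 - q) * A + (1 - \<alpha>) powr (2 - q) * B"
  shows "C powr (p - 1) \<le> A powr (p - 1) + B powr (p - 1)"
proof -
  have conj: "(p - 1) * (q - 1) = 1"
    using pq by (simp add: field_simps)
  have lim: "C \<le> X" if le: "\<And>\<alpha>. 0 < \<alpha> \<Longrightarrow> \<alpha> < 1 \<Longrightarrow> C \<le> (1 - \<alpha>) powr (2 - q) * X" for X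
  proof (rule tendsto_lowerbound)
    have "((\<lambda>\<alpha>. (1 - \<alpha>) powr (2 - q) * X) \<longlongrightarrow> (1 - 0) powr (2 - q) * X) (at_right (0::real))"
      by (intro tendsto_intros) auto
    then show "((\<lambda>\<alpha>. (1 - \<alpha>) powr (2 - q) * X) \<longlongrightarrow> X) (at_right (0::real))" by simp
    show "\<forall>\<^sub>F \<alpha> in at_right 0. C \<le> (1 - \<alpha>) powr (2 - q) * X"
      using le by (auto simp: eventually_at_right_field intro: exI[of _ 1])
  qed simp
  consider "A = 0" | "B = 0" | "A > 0" "B > 0" using AB by (metis less_eq_real_def)
  then show ?thesis
  proof cases
    case 1
    have "C \<le> B"
    proof (rule lim)
      fix \<alpha> :: real assume "0 < \<alpha>" "\<alpha> < 1"
      then show "C \<le> (1 - \<alpha>) powr (2 - q) * B" using le[of \<alpha>] 1 by simp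
    qed
    then show ?thesis using C pq 1 by (simp add: powr_mono2)
  next
    case 2
    have "C \<le> A"
    proof (rule lim)
      fix \<alpha> :: real assume "0 < \<alpha>" "\<alpha> < 1"
      then show "C \<le> (1 - \<alpha>) powr (2 - q) * A" using le[of "1 - \<alpha>"] 2 by simp
    qed
    then show ?thesis using C pq 2 by (simp add: powr_mono2)
  next
    case 3
    define E where "E = A powr (p - 1) + B powr (p - 1)"
    have E: "E > 0" using 3 by (simp add: E_def add_pos_pos)
    define \<alpha> where "\<alpha> = A powr (p - 1) / E"
    have \<alpha>: "0 < \<alpha>" "\<alpha> < 1" "1 - \<alpha> = B powr (p - 1) / E"
      using E 3 by (auto simp: \<alpha>_def E_def field_simps)
    have summand: "(X powr (p - 1) / E) powr (2 - q) * X = E powr (q - 2) * X powr (p - 1)"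
      if "X > 0" for X
    proof -
      have "(X powr (p - 1) / E) powr (2 - q) = X powr ((p - 1) * (2 - q)) / E powr (2 - q)"
        using E that by (simp add: powr_divide powr_powr)
      also have "(p - 1) * (2 - q) = (p - 1) - 1"
        using conj by (simp add: algebra_simps)
      also have "X powr ((p - 1) - 1) = X powr (p - 1) / X"
        using that by (subst powr_diff) simp
      also have "E powr (2 - q) = 1 / E powr (q - 2)"
        using powr_minus_divide[of E "q - 2"] by simp
      finally show ?thesis using that by simp
    qed
    have "C \<le> E powr (q - 2) * A powr (p - 1) + E powr (q - 2) * B powr (p - 1)"
      using le[OF \<alpha>(1,2)] unfolding \<alpha>(3) unfolding \<alpha>_def using 3 by (simp add: summand)
    also have "\<dots> = E * E powr (q - 2)"
      by (simp add: E_def algebra_simps)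
    also have "\<dots> = E powr (q - 1)"
      using E powr_mult_base[of E "q - 2"] by simp
    finally have "C powr (p - 1) \<le> (E powr (q - 1)) powr (p - 1)"
      using C pq by (intro powr_mono2) auto
    also have "\<dots> = E"
      using E conj by (simp add: powr_powr mult.commute)
    finally show ?thesis by (simp add: E_def)
  qed
qed

lemma dual_pairing_nonneg:
  fixes l m :: "'i \<Rightarrow> real"
  assumes q: "q \<ge> 1" and eq: "(\<Sum>i\<in>I. \<bar>l i\<bar> powr q) = (\<Sum>i\<in>I. \<bar>m i\<bar> powr q)"
  shows "0 \<le> (\<Sum>i\<in>I. (l i + m i) / 2 * spow (q - 1) (l i))"
proof -
  have "(\<Sum>i\<in>I. \<bar>l i\<bar> powr q + q * spow (q - 1) (l i) * (- m i - l i)) \<le> (\<Sum>i\<in>I. \<bar>- m i\<bar> powr q)"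
    using q by (intro sum_mono abs_powr_tangent)
  then have "(\<Sum>i\<in>I. q * spow (q - 1) (l i) * (- m i - l i)) \<le> 0"
    using eq by (simp add: sum.distrib)
  also have "(\<Sum>i\<in>I. q * spow (q - 1) (l i) * (- m i - l i))
      = - (2 * q) * (\<Sum>i\<in>I. (l i + m i) / 2 * spow (q - 1) (l i))"
    unfolding sum_distrib_left by (intro sum.cong) (auto simp: algebra_simps)
  finally show ?thesis using q by (simp add: zero_le_mult_iff)
qed

text \<open>The central inequality of the proof. For unit vectors \<open>l\<close> and \<open>m\<close> of \<open>\<ell>\<^sub>q\<close> with midpoint \<open>s\<close>, it
bounds from below the rates at which the \<open>\<ell>\<^sub>q\<close>-norm decreases when \<open>l\<close> and \<open>m\<close> are moved in the
direction \<open>- s\<close>. Clarkson's inequality would bound only the mean of the two rates, which is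
weaker when they differ, as the \<open>(p - 1)\<close>-th power is concave. Hence the weight \<open>\<alpha>\<close>, chosen
at the end by \<open>weighted_minimum_le\<close>.\<close>

lemma dual_pairings_ge_midpoint:
  fixes l m :: "'i \<Rightarrow> real"
  assumes pq: "p > 1" "q \<ge> 2" "1 / p + 1 / q = 1"
    and eq: "(\<Sum>i\<in>I. \<bar>l i\<bar> powr q) = (\<Sum>i\<in>I. \<bar>m i\<bar> powr q)"
  shows "2 * (\<Sum>i\<in>I. \<bar>(l i + m i) / 2\<bar> powr q) powr (p - 1)
    \<le> (\<Sum>i\<in>I. (l i + m i) / 2 * spow (q - 1) (l i)) powr (p - 1)
      + (\<Sum>i\<in>I. (l i + m i) / 2 * spow (q - 1) (m i)) powr (p - 1)"
proof -
  define s where "s i = (l i + m i) / 2" for i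
  define A where "A = (\<Sum>i\<in>I. s i * spow (q - 1) (l i))"
  define B where "B = (\<Sum>i\<in>I. s i * spow (q - 1) (m i))"
  define S where "S = (\<Sum>i\<in>I. \<bar>s i\<bar> powr q)"
  have conj: "(p - 1) * (q - 1) = 1"
    using pq by (simp add: field_simps)
  have S: "S \<ge> 0" by (simp add: S_def sum_nonneg)
  have "2 powr (q - 1) * S \<le> \<alpha> powr (2 - q) * A + (1 - \<alpha>) powr (2 - q) * B"
    if \<alpha>: "0 < \<alpha>" "\<alpha> < 1" for \<alpha>
  proof -
    let ?d = "((1 - \<alpha>) powr (2 - q) - \<alpha> powr (2 - q)) / q"
    have "(\<Sum>i\<in>I. \<bar>l i + m i\<bar> powr q) \<le> (\<Sum>i\<in>I. (l i + m i) *
        (\<alpha> powr (2 - q) * spow (q - 1) (l i) + (1 - \<alpha>) powr (2 - q) * spow (q - 1) (m i))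
        + ?d * (\<bar>l i\<bar> powr q - \<bar>m i\<bar> powr q))"
      using pq \<alpha> by (intro sum_mono clarkson_weighted)
    also have "\<dots> = 2 * (\<alpha> powr (2 - q) * A + (1 - \<alpha>) powr (2 - q) * B)
        + ?d * ((\<Sum>i\<in>I. \<bar>l i\<bar> powr q) - (\<Sum>i\<in>I. \<bar>m i\<bar> powr q))"
      unfolding A_def B_def sum_distrib_left sum.distrib[symmetric] sum_subtractf[symmetric]
      by (intro sum.cong refl) (simp add: s_def field_simps)
    also have "\<dots> = 2 * (\<alpha> powr (2 - q) * A + (1 - \<alpha>) powr (2 - q) * B)"
      using eq by simp
    also have "(\<Sum>i\<in>I. \<bar>l i + m i\<bar> powr q) = 2 powr q * S"
      unfolding S_def s_def sum_distrib_left
      by (intro sum.cong) (auto simp: powr_divide)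
    also have "2 powr q = 2 * 2 powr (q - 1)"
      using powr_mult_base[of 2 "q - 1"] by simp
    finally show ?thesis by simp
  qed
  moreover have "A \<ge> 0"
    unfolding A_def s_def using pq eq by (intro dual_pairing_nonneg) auto
  moreover have "B \<ge> 0"
    using dual_pairing_nonneg[of q m I l] pq eq by (simp add: B_def s_def add.commute)
  ultimately have "(2 powr (q - 1) * S) powr (p - 1) \<le> A powr (p - 1) + B powr (p - 1)"
    using pq S by (intro weighted_minimum_le) auto
  moreover have "(2 powr (q - 1) * S) powr (p - 1) = 2 * S powr (p - 1)"
    using S conj by (simp add: powr_mult powr_powr mult.commute)
  ultimately show ?thesis
    by (simp add: A_def B_def S_def s_def)
qed

text \<open>Moving \<open>l\<close> by \<open>- \<zeta> * s\<close> costs \<open>\<zeta> * r\<close> but lowers \<open>\<Sum>i\<in>I. \<bar>l i\<bar> powr q\<close> by about \<open>q * \<zeta> * A\<close>,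
which makes room for a coordinate \<open>\<nu>\<close> along a new vector of size \<open>\<epsilon> powr (1 / p)\<close>. With
\<open>\<zeta>\<close> of order \<open>\<epsilon>\<close> and \<open>\<nu>\<close> of order \<open>\<epsilon> powr (1 / q)\<close> both effects have order \<open>\<epsilon>\<close>; the bound on
\<open>K\<close> is the net gain per \<open>\<epsilon>\<close> for the best choice.\<close>

lemma perturbation_gain:
  fixes l s :: "'i \<Rightarrow> real"
  assumes pq: "p > 1" "q \<ge> 2" "1 / p + 1 / q = 1"
    and l: "(\<Sum>i\<in>I. \<bar>l i\<bar> powr q) = 1"
    and A: "A = (\<Sum>i\<in>I. s i * spow (q - 1) (l i))" "A \<ge> 0"
    and rg: "r > 0" "g > 0" and K: "K < g powr p * A powr (p - 1) * r powr (1 - p) / p"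
  shows "\<forall>\<^sub>F \<epsilon> in at_right 0. \<exists>\<zeta> \<nu>. (\<Sum>i\<in>I. \<bar>l i - \<zeta> * s i\<bar> powr q) + \<bar>\<nu>\<bar> powr q \<le> 1
    \<and> \<epsilon> * K \<le> \<nu> * \<epsilon> powr (1 / p) * g - \<zeta> * r"
proof (cases "A = 0")
  case True
  have "(\<Sum>i\<in>I. \<bar>l i - 0 * s i\<bar> powr q) + \<bar>0\<bar> powr q \<le> 1
    \<and> \<epsilon> * K \<le> 0 * \<epsilon> powr (1 / p) * g - 0 * r" if "\<epsilon> > 0" for \<epsilon>
    using l that K pq True by (simp add: mult_le_0_iff)
  then have "\<exists>\<zeta> \<nu>. (\<Sum>i\<in>I. \<bar>l i - \<zeta> * s i\<bar> powr q) + \<bar>\<nu>\<bar> powr q \<le> 1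
    \<and> \<epsilon> * K \<le> \<nu> * \<epsilon> powr (1 / p) * g - \<zeta> * r" if "\<epsilon> > 0" for \<epsilon>
    using that by blast
  then show ?thesis by (intro eventually_at_rightI[of 0 1]) auto
next
  case False
  then have "A > 0" using A by simp
  define B where "B = g powr p * A powr (p - 1) * r powr (1 - p)"
  have B: "B > 0" using rg \<open>A > 0\<close> by (simp add: B_def)
  have "K / B < 1 / p" using K B by (simp add: B_def field_simps)
  then have "max 0 (K / B + 1 / q) < 1" using pq by simp
  then obtain \<theta> where \<theta>: "max 0 (K / B + 1 / q) < \<theta>" "\<theta> < 1" using dense by blast
  define x where "x = g * A / r"
  have x: "x > 0" using rg \<open>A > 0\<close> by (simp add: x_def)
  have xp: "x powr p = x * x powr (p - 1)"
    using powr_mult_base[of x "p - 1"] x by simp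
  have xB: "g * x powr (p - 1) = B"
  proof -
    have "x powr (p - 1) = g powr (p - 1) * A powr (p - 1) / r powr (p - 1)"
      using rg \<open>A > 0\<close> by (simp add: x_def powr_mult powr_divide)
    moreover have "r powr (1 - p) = 1 / r powr (p - 1)"
      using powr_minus_divide[of r "p - 1"] by simp
    moreover have "g * g powr (p - 1) = g powr p"
      using powr_mult_base[of g "p - 1"] rg by simp
    ultimately show ?thesis by (simp add: B_def flip: mult.assoc)
  qed
  \<comment> \<open>The maximum of \<open>n * g - X * r\<close> under the first order constraint \<open>n powr q = q * A * X\<close>; the factor
    \<open>\<theta> < 1\<close> in \<open>n\<close> below turns this constraint into a strict inequality.\<close>
  define X where "X = x powr p / (q * A)"
  have Xr: "X * r = B / q"
  proof -
    have "X * r = (x * r) * x powr (p - 1) / (q * A)"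
      by (simp add: X_def xp)
    also have "x * r = A * g"
      using rg by (simp add: x_def)
    also have "A * g * x powr (p - 1) / (q * A) = g * x powr (p - 1) / q"
      using \<open>A > 0\<close> by simp
    finally show ?thesis by (simp add: xB)
  qed
  define n where "n = \<theta> * x powr (p - 1)"
  have conj: "(p - 1) * q = p"
    using pq by (simp add: field_simps)
  have n: "n \<ge> 0" "n powr q = \<theta> powr q * x powr p"
    using \<theta> x conj by (auto simp: n_def powr_mult powr_powr)
  have "\<theta> powr q < 1 powr q"
    using \<theta> pq by (intro powr_less_mono2) auto
  then have "A * \<theta> powr q < A"
    using \<open>A > 0\<close> by simp
  moreover have "((\<lambda>\<epsilon>. \<Sum>i\<in>I. s i * spow (q - 1) (l i - \<epsilon> * X * s i)) \<longlongrightarrow>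
      (\<Sum>i\<in>I. s i * spow (q - 1) (l i - 0 * X * s i))) (at_right 0)"
  proof (intro tendsto_intros)
    fix i
    have "isCont (spow (q - 1)) (l i - 0 * X * s i)"
      using continuous_spow[of "q - 1"] pq continuous_on_eq_continuous_at[of UNIV "spow (q - 1)"] by auto
    then show "((\<lambda>\<epsilon>. spow (q - 1) (l i - \<epsilon> * X * s i)) \<longlongrightarrow> spow (q - 1) (l i - 0 * X * s i)) (at_right 0)"
      by (rule isCont_tendsto_compose) (intro tendsto_intros)
  qed
  ultimately have "\<forall>\<^sub>F \<epsilon> in at_right 0. A * \<theta> powr q < (\<Sum>i\<in>I. s i * spow (q - 1) (l i - \<epsilon> * X * s i))"
    using A(1) by (intro order_tendstoD(1)) auto
  moreover have "\<forall>\<^sub>F \<epsilon> in at_right (0::real). \<epsilon> > 0"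
    by (simp add: eventually_at_right_less)
  ultimately show ?thesis
  proof eventually_elim
    case (elim \<epsilon>)
    define \<zeta> where "\<zeta> = \<epsilon> * X"
    define \<nu> where "\<nu> = \<epsilon> powr (1 / q) * n"
    have \<zeta>: "\<zeta> > 0" using elim x \<open>A > 0\<close> pq by (simp add: \<zeta>_def X_def)
    have "\<nu> \<ge> 0" using n by (simp add: \<nu>_def)
    then have \<nu>q: "\<bar>\<nu>\<bar> powr q = \<epsilon> * (\<theta> powr q * x powr p)"
      using n elim pq by (simp add: \<nu>_def powr_mult powr_powr)
    have "(\<Sum>i\<in>I. \<bar>l i - \<zeta> * s i\<bar> powr q + q * spow (q - 1) (l i - \<zeta> * s i) * (l i - (l i - \<zeta> * s i)))
        \<le> (\<Sum>i\<in>I. \<bar>l i\<bar> powr q)"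
      using pq by (intro sum_mono abs_powr_tangent) auto
    also have "(\<Sum>i\<in>I. \<bar>l i - \<zeta> * s i\<bar> powr q + q * spow (q - 1) (l i - \<zeta> * s i) * (l i - (l i - \<zeta> * s i)))
      = (\<Sum>i\<in>I. \<bar>l i - \<zeta> * s i\<bar> powr q) + q * \<zeta> * (\<Sum>i\<in>I. s i * spow (q - 1) (l i - \<zeta> * s i))"
      unfolding sum.distrib sum_distrib_left by (intro arg_cong2[of _ _ _ _ "(+)"] sum.cong) (auto simp: algebra_simps)
    finally have "(\<Sum>i\<in>I. \<bar>l i - \<zeta> * s i\<bar> powr q) + q * \<zeta> * (\<Sum>i\<in>I. s i * spow (q - 1) (l i - \<zeta> * s i)) \<le> 1"
      using l by simp
    moreover have "q * \<zeta> * (A * \<theta> powr q) \<le> q * \<zeta> * (\<Sum>i\<in>I. s i * spow (q - 1) (l i - \<zeta> * s i))"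
      using elim \<zeta> pq by (intro mult_left_mono) (auto simp: \<zeta>_def)
    moreover have "q * \<zeta> * (A * \<theta> powr q) = \<bar>\<nu>\<bar> powr q"
      using \<open>A > 0\<close> pq by (simp add: \<nu>q \<zeta>_def X_def)
    ultimately have 1: "(\<Sum>i\<in>I. \<bar>l i - \<zeta> * s i\<bar> powr q) + \<bar>\<nu>\<bar> powr q \<le> 1"
      by linarith
    have "\<epsilon> powr (1 / q) * \<epsilon> powr (1 / p) = \<epsilon>"
      using pq(3) elim by (simp add: add.commute flip: powr_add)
    then have "\<nu> * \<epsilon> powr (1 / p) * g = \<epsilon> * (n * g)"
      by (simp add: \<nu>_def mult.commute mult.left_commute)
    also have "n * g = \<theta> * B"
      by (simp add: n_def mult_ac flip: xB)
    finally have "\<nu> * \<epsilon> powr (1 / p) * g - \<zeta> * r = \<epsilon> * (\<theta> * B - B / q)"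
      using Xr by (simp add: \<zeta>_def right_diff_distrib mult.assoc)
    moreover have "K \<le> \<theta> * B - B / q"
    proof -
      have "K / B + 1 / q \<le> \<theta>" using \<theta> by simp
      then have "(K / B + 1 / q) * B \<le> \<theta> * B" using B by (intro mult_right_mono) auto
      then show ?thesis using B by (simp add: distrib_right)
    qed
    ultimately have "\<epsilon> * K \<le> \<nu> * \<epsilon> powr (1 / p) * g - \<zeta> * r"
      using elim by (auto intro: mult_left_mono)
    with 1 show ?case by blast
  qed
qed

section \<open>Support functions and coordinates of zonotopes\<close>

lemma support_fun_segment: "support_fun (closed_segment (- v) v) x = \<bar>x \<bullet> v\<bar>"
proof -
  have cb: "convex_body (closed_segment (- v) v)"
    by (simp add: convex_body_def)
  obtain y where y: "y \<in> closed_segment (- v) v" "support_fun (closed_segment (- v) v) x = x \<bullet> y"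
    using support_fun_attained[OF cb] by blast
  then obtain t where t: "0 \<le> t" "t \<le> 1" "y = (1 - t) *\<^sub>R (- v) + t *\<^sub>R v"
    by (auto simp: closed_segment_def)
  have "x \<bullet> y = (2 * t - 1) * (x \<bullet> v)"
    unfolding t(3) by (simp add: inner_add_right inner_diff_right algebra_simps)
  also have "\<dots> \<le> \<bar>2 * t - 1\<bar> * \<bar>x \<bullet> v\<bar>"
    by (metis abs_ge_self abs_mult)
  also have "\<dots> \<le> 1 * \<bar>x \<bullet> v\<bar>"
    using t by (intro mult_right_mono) auto
  finally have "support_fun (closed_segment (- v) v) x \<le> \<bar>x \<bullet> v\<bar>"
    using y by simp
  moreover have "\<bar>x \<bullet> v\<bar> \<le> support_fun (closed_segment (- v) v) x"
    using support_fun_upper[OF cb, of v x] support_fun_upper[OF cb, of "- v" x] by (simp add: abs_le_iff)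
  ultimately show ?thesis by simp
qed

lemma segment_convex_body: "convex_body (closed_segment (- v) v)" "0 \<in> closed_segment (- v) v"
  using midpoint_in_closed_segment[of "- v" v] by (auto simp: convex_body_def midpoint_def)

lemma lp_sum_eqI:
  fixes K L M :: "'a::euclidean_space set"
  assumes "p \<ge> 1" "convex_body K" "0 \<in> K" "convex_body L" "0 \<in> L"
    and "convex_body M" "0 \<in> M"
    and "\<And>x. support_fun M x powr p = support_fun K x powr p + support_fun L x powr p"
  shows "lp_sum p K L = M"
  unfolding lp_sum_def using assms by (intro the1_equality lp_sum_ex1) auto

lemma support_fun_lp_sum:
  fixes K L :: "'a::euclidean_space set"
  assumes "p \<ge> 1" "convex_body K" "0 \<in> K" "convex_body L" "0 \<in> L"
  shows "support_fun (lp_sum p K L) x = (support_fun K x powr p + support_fun L x powr p) powr (1 / p)"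
  using lp_sum_props[OF assms] support_fun_nonneg[of "lp_sum p K L" x] assms(1)
  by (simp add: powr_powr flip: lp_sum_props(3)[OF assms])

lemma support_fun_le_imp_mem:
  assumes "convex_body L" "\<And>x. x \<bullet> y \<le> support_fun L x"
  shows "y \<in> L"
  using support_fun_le_imp_subset[of "{y}" L] assms by (auto simp: convex_body_def support_fun_def)

lemma support_fun_mono:
  assumes "convex_body K" "convex_body L" "K \<subseteq> L"
  shows "support_fun K x \<le> support_fun L x"
  by (metis assms support_fun_attained support_fun_upper subsetD)

text \<open>The points of this form make up a compact convex set, whose support function is at least that of
the \<open>L\<^sub>p\<close>-sum because every pair of support values is attained by some coefficient pair.\<close>

lemma lp_sum_combination:
  fixes K L :: "'a::euclidean_space set"
  assumes p: "p \<ge> 1" and K: "convex_body K" "0 \<in> K" and L: "convex_body L" "0 \<in> L"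
    and y: "y \<in> lp_sum p K L"
  obtains a b k l where "(a, b) \<in> lp_coeffs p" "k \<in> K" "l \<in> L" "y = a *\<^sub>R k + b *\<^sub>R l"
proof -
  define M where "M = (\<lambda>(c, k, l). fst c *\<^sub>R k + snd c *\<^sub>R l) ` (lp_coeffs p \<times> K \<times> L)"
  have M_iff: "z \<in> M \<longleftrightarrow> (\<exists>a b k l. (a, b) \<in> lp_coeffs p \<and> k \<in> K \<and> l \<in> L \<and> z = a *\<^sub>R k + b *\<^sub>R l)"
    for z
    by (force simp: M_def)
  have "compact M"
    unfolding M_def case_prod_beta using K L
    by (intro compact_continuous_image compact_Times lp_coeffs_compact continuous_intros)
       (auto simp: convex_body_def)
  moreover have "convex M"
  proof (rule convexI)
    fix y z u v assume "y \<in> M" "z \<in> M" and uv: "0 \<le> u" "0 \<le> v" "u + v = (1::real)"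
    then obtain a b k l a' b' k' l' where
      1: "(a, b) \<in> lp_coeffs p" "k \<in> K" "l \<in> L" "y = a *\<^sub>R k + b *\<^sub>R l" and
      2: "(a', b') \<in> lp_coeffs p" "k' \<in> K" "l' \<in> L" "z = a' *\<^sub>R k' + b' *\<^sub>R l'"
      unfolding M_iff by blast
    have nn: "0 \<le> u * a" "0 \<le> v * a'" "0 \<le> u * b" "0 \<le> v * b'"
      using 1(1) 2(1) uv by (auto simp: lp_coeffs_def)
    obtain k'' where k: "k'' \<in> K" "(u * a) *\<^sub>R k + (v * a') *\<^sub>R k' = (u * a + v * a') *\<^sub>R k''"
      using convex_cone_add[of K k k'] K 1 2 nn by (auto simp: convex_body_def)
    obtain l'' where l: "l'' \<in> L" "(u * b) *\<^sub>R l + (v * b') *\<^sub>R l' = (u * b + v * b') *\<^sub>R l''"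
      using convex_cone_add[of L l l'] L 1 2 nn by (auto simp: convex_body_def)
    have "u *\<^sub>R y + v *\<^sub>R z = (u * a + v * a') *\<^sub>R k'' + (u * b + v * b') *\<^sub>R l''"
      unfolding k(2)[symmetric] l(2)[symmetric] 1(4) 2(4) by (simp add: scaleR_add_right)
    with k l lp_coeffs_convex[OF 1(1) 2(1) uv] show "u *\<^sub>R y + v *\<^sub>R z \<in> M"
      unfolding M_iff by blast
  qed
  moreover have "M \<noteq> {}"
  proof -
    obtain a b where "(a, b) \<in> lp_coeffs p"
      using lp_coeffs_attained[OF p order_refl order_refl] by blast
    then have "a *\<^sub>R 0 + b *\<^sub>R 0 \<in> M"
      unfolding M_iff using K L by blast
    then show ?thesis by blast
  qed
  ultimately have M: "convex_body M" by (auto simp: convex_body_def)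
  have "support_fun (lp_sum p K L) x \<le> support_fun M x" for x
  proof -
    obtain a b where ab: "(a, b) \<in> lp_coeffs p"
      "a * support_fun K x + b * support_fun L x
         = (support_fun K x powr p + support_fun L x powr p) powr (1 / p)"
      using lp_coeffs_attained[OF p support_fun_nonneg[OF K] support_fun_nonneg[OF L]] by blast
    obtain k where k: "k \<in> K" "support_fun K x = x \<bullet> k"
      using support_fun_attained[OF K(1)] by blast
    obtain l where l: "l \<in> L" "support_fun L x = x \<bullet> l"
      using support_fun_attained[OF L(1)] by blast
    have "a *\<^sub>R k + b *\<^sub>R l \<in> M"
      unfolding M_iff using ab k l by blast
    from support_fun_upper[OF M this, of x] show ?thesis
      using ab(2) k(2) l(2) by (simp add: support_fun_lp_sum[OF p K L] inner_add_right)
  qed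
  then have "lp_sum p K L \<subseteq> M"
    by (intro support_fun_le_imp_subset lp_sum_props(1)[OF p K L] M)
  with y have "y \<in> M" by blast
  then show ?thesis unfolding M_iff using that by blast
qed

text \<open>The test pair \<open>(a powr (q - 1), b powr (q - 1))\<close> is the equality case of Hoelder's inequality.\<close>

lemma lp_coeffs_dual:
  assumes pq: "p > 1" "q > 1" "1 / p + 1 / q = 1" and ab: "(a, b) \<in> lp_coeffs p"
  shows "a powr q + b powr q \<le> 1"
proof (rule ccontr)
  assume "\<not> ?thesis"
  then have N: "a powr q + b powr q > 1" (is "?N > 1") by simp
  have nn: "a \<ge> 0" "b \<ge> 0" using ab by (auto simp: lp_coeffs_def)
  have conj: "(q - 1) * p = q" using pq by (simp add: field_simps)
  have "a * a powr (q - 1) + b * b powr (q - 1)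
      \<le> ((a powr (q - 1)) powr p + (b powr (q - 1)) powr p) powr (1 / p)"
    using ab by (auto simp: lp_coeffs_def)
  then have "?N \<le> ?N powr (1 / p)"
    using nn by (simp add: powr_mult_base powr_powr conj)
  also have "\<dots> < ?N powr 1"
    using N pq by (intro powr_less_mono) auto
  finally show False using N by simp
qed

lemma segment_multiple:
  fixes y w :: "'a::real_vector"
  assumes "y \<in> closed_segment (- w) w"
  obtains t where "\<bar>t\<bar> \<le> 1" "y = t *\<^sub>R w"
proof -
  obtain t where t: "0 \<le> t" "t \<le> 1" "y = (1 - t) *\<^sub>R (- w) + t *\<^sub>R w"
    using assms unfolding closed_segment_def by blast
  have "y = (- (1 - t) + t) *\<^sub>R w"
    unfolding t(3) by (simp only: scaleR_left_distrib scaleR_minus_left scaleR_minus_right)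
  moreover have "\<bar>- (1 - t) + t\<bar> \<le> 1" using t by simp
  ultimately show thesis by (rule that[rotated])
qed

lemma lp_zonotope_coordinates_le:
  fixes A :: "'a::euclidean_space set"
  assumes pq: "p > 1" "q > 1" "1 / p + 1 / q = 1" and A: "lp_zonotope p A"
  shows "\<exists>(n::nat) v. (\<forall>x. support_fun A x powr p = (\<Sum>i<n. \<bar>x \<bullet> v i\<bar> powr p)) \<and>
    (\<forall>y\<in>A. \<exists>l. (\<Sum>i<n. \<bar>l i\<bar> powr q) \<le> 1 \<and> y = (\<Sum>i<n. l i *\<^sub>R v i))"
  using A
proof (induction rule: lp_zonotope.induct)
  case (segment w)
  have "\<exists>l. (\<Sum>i<Suc 0. \<bar>l i\<bar> powr q) \<le> 1 \<and> y = (\<Sum>i<Suc 0. l i *\<^sub>R w)"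
    if y: "y \<in> closed_segment (- w) w" for y
  proof -
    obtain t where t: "\<bar>t\<bar> \<le> 1" "y = t *\<^sub>R w" using segment_multiple[OF y] .
    have "\<bar>t\<bar> powr q \<le> 1 powr q" using t pq by (intro powr_mono2) auto
    then show ?thesis using t by (intro exI[of _ "\<lambda>_. t"]) simp
  qed
  then show ?case
    by (intro exI[of _ "Suc 0"] exI[of _ "\<lambda>_. w"] conjI ballI allI) (simp_all add: support_fun_segment)
next
  case (sum Z w)
  from sum.IH obtain n :: nat and v where
    h: "\<forall>x. support_fun Z x powr p = (\<Sum>i<n. \<bar>x \<bullet> v i\<bar> powr p)" and
    c: "\<forall>y\<in>Z. \<exists>l. (\<Sum>i<n. \<bar>l i\<bar> powr q) \<le> 1 \<and> y = (\<Sum>i<n. l i *\<^sub>R v i)"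
    by (elim exE conjE)
  have p: "p \<ge> 1" using pq by simp
  have Z: "convex_body Z" "0 \<in> Z" using lp_zonotope_convex_body[OF sum.hyps p] by auto
  define v' where "v' = v(n := w)"
  have "support_fun (lp_sum p Z (closed_segment (- w) w)) x powr p = (\<Sum>i<Suc n. \<bar>x \<bullet> v' i\<bar> powr p)" for x
  proof -
    have "(\<Sum>i<n. \<bar>x \<bullet> v' i\<bar> powr p) = (\<Sum>i<n. \<bar>x \<bullet> v i\<bar> powr p)"
      by (intro sum.cong refl) (simp add: v'_def)
    then show ?thesis
      unfolding lp_sum_props(3)[OF p Z segment_convex_body] support_fun_segment h[rule_format]
      by (simp add: v'_def)
  qed
  moreover have "\<exists>l. (\<Sum>i<Suc n. \<bar>l i\<bar> powr q) \<le> 1 \<and> y = (\<Sum>i<Suc n. l i *\<^sub>R v' i)"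
    if y: "y \<in> lp_sum p Z (closed_segment (- w) w)" for y
  proof -
    obtain a b k s where ab: "(a, b) \<in> lp_coeffs p" and k: "k \<in> Z"
      and s: "s \<in> closed_segment (- w) w" and y_eq: "y = a *\<^sub>R k + b *\<^sub>R s"
      using lp_sum_combination[OF p Z segment_convex_body y] .
    obtain t where t: "\<bar>t\<bar> \<le> 1" "s = t *\<^sub>R w" using segment_multiple[OF s] .
    have "\<exists>l. (\<Sum>i<n. \<bar>l i\<bar> powr q) \<le> 1 \<and> k = (\<Sum>i<n. l i *\<^sub>R v i)"
      using c k by (rule bspec)
    then obtain l where l: "(\<Sum>i<n. \<bar>l i\<bar> powr q) \<le> 1" "k = (\<Sum>i<n. l i *\<^sub>R v i)"
      by (elim exE conjE)
    have nn: "a \<ge> 0" "b \<ge> 0" using ab by (auto simp: lp_coeffs_def)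
    have tq: "\<bar>t\<bar> powr q \<le> 1 powr q" using t pq by (intro powr_mono2) auto
    define l' where "l' = (\<lambda>i. a * l i)(n := b * t)"
    have "(\<Sum>i<n. \<bar>l' i\<bar> powr q) = a powr q * (\<Sum>i<n. \<bar>l i\<bar> powr q)"
      unfolding sum_distrib_left using nn
      by (intro sum.cong refl) (simp add: l'_def abs_mult powr_mult)
    then have "(\<Sum>i<Suc n. \<bar>l' i\<bar> powr q) = a powr q * (\<Sum>i<n. \<bar>l i\<bar> powr q) + b powr q * \<bar>t\<bar> powr q"
      using nn by (simp add: l'_def abs_mult powr_mult)
    also have "\<dots> \<le> a powr q * 1 + b powr q * 1"
      using l tq by (intro add_mono mult_left_mono) auto
    also have "\<dots> \<le> 1" using lp_coeffs_dual[OF pq ab] by simp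
    finally have "(\<Sum>i<Suc n. \<bar>l' i\<bar> powr q) \<le> 1" .
    moreover have "y = (\<Sum>i<Suc n. l' i *\<^sub>R v' i)"
    proof -
      have "(\<Sum>i<n. l' i *\<^sub>R v' i) = a *\<^sub>R k"
        unfolding l(2) scaleR_sum_right by (intro sum.cong refl) (simp add: l'_def v'_def)
      then show ?thesis by (simp add: y_eq t(2) l'_def v'_def)
    qed
    ultimately show ?thesis by blast
  qed
  ultimately show ?case
    by (intro exI[of _ "Suc n"] exI[of _ v'] conjI ballI allI)
qed

text \<open>An \<open>L\<^sub>p\<close>-zonotope is a linear image of the unit ball of \<open>\<ell>\<^sub>q\<close>. Adding the zero vector to the
generators supplies a dummy coordinate, so that every point, whether on the boundary or not, comes from
a unit vector.\<close>

lemma lp_zonotope_coordinates: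
  fixes A :: "'a::euclidean_space set"
  assumes pq: "p > 1" "q > 1" "1 / p + 1 / q = 1" and A: "lp_zonotope p A"
  obtains n :: nat and v where "\<And>x. support_fun A x powr p = (\<Sum>i<n. \<bar>x \<bullet> v i\<bar> powr p)"
    "\<And>y. y \<in> A \<Longrightarrow> \<exists>l. (\<Sum>i<n. \<bar>l i\<bar> powr q) = 1 \<and> y = (\<Sum>i<n. l i *\<^sub>R v i)"
proof -
  obtain n :: nat and v where
    h: "\<forall>x. support_fun A x powr p = (\<Sum>i<n. \<bar>x \<bullet> v i\<bar> powr p)" and
    c: "\<forall>y\<in>A. \<exists>l. (\<Sum>i<n. \<bar>l i\<bar> powr q) \<le> 1 \<and> y = (\<Sum>i<n. l i *\<^sub>R v i)"
    using lp_zonotope_coordinates_le[OF assms] by (elim exE conjE)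
  define v' where "v' = v(n := 0)"
  have "support_fun A x powr p = (\<Sum>i<Suc n. \<bar>x \<bullet> v' i\<bar> powr p)" for x
    by (simp add: h v'_def)
  moreover have "\<exists>l. (\<Sum>i<Suc n. \<bar>l i\<bar> powr q) = 1 \<and> y = (\<Sum>i<Suc n. l i *\<^sub>R v' i)" if y: "y \<in> A" for y
  proof -
    obtain l where l: "(\<Sum>i<n. \<bar>l i\<bar> powr q) \<le> 1" "y = (\<Sum>i<n. l i *\<^sub>R v i)"
      using c y by blast
    define l' where "l' = l(n := (1 - (\<Sum>i<n. \<bar>l i\<bar> powr q)) powr (1 / q))"
    have "(\<Sum>i<Suc n. \<bar>l' i\<bar> powr q) = 1"
      using l pq by (simp add: l'_def powr_powr)
    moreover have "y = (\<Sum>i<Suc n. l' i *\<^sub>R v' i)"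
      by (simp add: l l'_def v'_def)
    ultimately show ?thesis by blast
  qed
  ultimately show thesis by (rule that)
qed

text \<open>The converse inclusion, by Hoelder's inequality in every direction.\<close>

lemma combination_in_lp_sum_segment:
  fixes A :: "'a::euclidean_space set" and n :: nat
  assumes pq: "p > 1" "q > 1" "1 / p + 1 / q = 1" and A: "convex_body A" "0 \<in> A"
    and h: "\<And>x. support_fun A x powr p = (\<Sum>i<n. \<bar>x \<bullet> v i\<bar> powr p)"
    and le: "(\<Sum>i<n. \<bar>l i\<bar> powr q) + \<bar>\<nu>\<bar> powr q \<le> 1"
  shows "(\<Sum>i<n. l i *\<^sub>R v i) + \<nu> *\<^sub>R w \<in> lp_sum p A (closed_segment (- w) w)"
proof (rule support_fun_le_imp_mem)
  have p: "p \<ge> 1" using pq by simp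
  show "convex_body (lp_sum p A (closed_segment (- w) w))"
    using lp_sum_props(1)[OF p A segment_convex_body] .
  fix x
  define v' where "v' = v(n := w)"
  define l' where "l' = l(n := \<nu>)"
  have "x \<bullet> ((\<Sum>i<n. l i *\<^sub>R v i) + \<nu> *\<^sub>R w) = (\<Sum>i<Suc n. (x \<bullet> v' i) * l' i)"
    by (simp add: v'_def l'_def inner_add_right inner_sum_right mult.commute)
  also have "\<dots> \<le> (\<Sum>i<Suc n. \<bar>x \<bullet> v' i\<bar> powr p) powr (1 / p) * (\<Sum>i<Suc n. \<bar>l' i\<bar> powr q) powr (1 / q)"
    using pq by (intro Holder_sum) auto
  also have "\<dots> \<le> (\<Sum>i<Suc n. \<bar>x \<bullet> v' i\<bar> powr p) powr (1 / p) * 1 powr (1 / q)"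
    using le pq by (intro mult_left_mono powr_mono2) (auto simp: l'_def sum_nonneg)
  also have "\<dots> = support_fun (lp_sum p A (closed_segment (- w) w)) x"
    by (simp add: support_fun_lp_sum[OF p A segment_convex_body] support_fun_segment h v'_def)
  finally show "x \<bullet> ((\<Sum>i<n. l i *\<^sub>R v i) + \<nu> *\<^sub>R w) \<le> support_fun (lp_sum p A (closed_segment (- w) w)) x" .
qed

section \<open>Growth of chords\<close>

text \<open>Write the endpoints of a chord as \<open>y = \<Sum>i. l i *\<^sub>R u i\<close> and \<open>- y' = \<Sum>i. k i *\<^sub>R u i\<close> with unit vectors
\<open>l\<close> and \<open>k\<close> of \<open>\<ell>\<^sub>q\<close>, and let \<open>s\<close> be their midpoint. The vector \<open>\<Sum>i. s i *\<^sub>R u i\<close> is half the chord, so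
perturbing \<open>l\<close> and \<open>k\<close> along \<open>s\<close> keeps both endpoints on the line of the chord, and so does adding a
multiple of \<open>v\<close>. The total gain is governed by \<open>dual_pairings_ge_midpoint\<close>, where the norm of \<open>s\<close> is at
least \<open>r\<close> divided by the support value of \<open>A\<close>, again by Hoelder. This is where the right growth
rate of \<open>(support_fun A w powr p + \<epsilon> * (w \<bullet> v) powr p) powr (1 / p)\<close> appears.\<close>

lemma chord_growth_infinitesimal:
  fixes A :: "'a::euclidean_space set"
  assumes p: "1 < p" "p \<le> 2" and A: "lp_zonotope p A"
    and y: "y \<in> A" "y' \<in> A" "c \<bullet> y = c \<bullet> y'" "w \<bullet> (y - y') > 0"
    and m: "support_fun A w > 0" and v: "w \<bullet> v > 0" "c \<bullet> v = 0" and \<eta>: "\<eta> > 0"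
  shows "\<forall>\<^sub>F \<epsilon> in at_right 0.
    \<exists>Y \<in> lp_sum p A (closed_segment (- (\<epsilon> powr (1 / p) *\<^sub>R v)) (\<epsilon> powr (1 / p) *\<^sub>R v)).
    \<exists>Y' \<in> lp_sum p A (closed_segment (- (\<epsilon> powr (1 / p) *\<^sub>R v)) (\<epsilon> powr (1 / p) *\<^sub>R v)).
      c \<bullet> Y = c \<bullet> y \<and> c \<bullet> Y' = c \<bullet> y \<and>
      w \<bullet> (y - y') + \<epsilon> * (w \<bullet> (y - y') * (w \<bullet> v) powr p / (p * support_fun A w powr p) - \<eta>)
        \<le> w \<bullet> (Y - Y')"
proof -
  define q where "q = p / (p - 1)"
  have pq: "1 / p + 1 / q = 1" "q \<ge> 2" "q > 1"
    using p by (auto simp: q_def field_simps)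
  have p1: "p \<ge> 1" using p by simp
  have Ac: "convex_body A" "0 \<in> A" using lp_zonotope_convex_body[OF A p1] by auto
  obtain n :: nat and u where
    h: "\<And>x. support_fun A x powr p = (\<Sum>i<n. \<bar>x \<bullet> u i\<bar> powr p)" and
    coord: "\<And>y. y \<in> A \<Longrightarrow> \<exists>l. (\<Sum>i<n. \<bar>l i\<bar> powr q) = 1 \<and> y = (\<Sum>i<n. l i *\<^sub>R u i)"
    by (rule lp_zonotope_coordinates[OF p(1) pq(3,1) A], rule that)
  obtain l where l: "(\<Sum>i<n. \<bar>l i\<bar> powr q) = 1" "y = (\<Sum>i<n. l i *\<^sub>R u i)"
    using coord[OF y(1)] by blast
  obtain m' where m': "(\<Sum>i<n. \<bar>m' i\<bar> powr q) = 1" "y' = (\<Sum>i<n. m' i *\<^sub>R u i)"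
    using coord[OF y(2)] by blast
  define k where "k i = - m' i" for i
  have k: "(\<Sum>i<n. \<bar>k i\<bar> powr q) = 1" "(\<Sum>i<n. k i *\<^sub>R u i) = - y'"
    using m' by (simp_all add: k_def sum_negf)
  define s where "s i = (l i + k i) / 2" for i
  define r where "r = w \<bullet> (y - y') / 2"
  define g where "g = w \<bullet> v"
  define M where "M = support_fun A w"
  have pos: "r > 0" "g > 0" "M > 0" using y v m by (auto simp: r_def g_def M_def)
  have su: "(\<Sum>i<n. s i *\<^sub>R u i) = (1 / 2) *\<^sub>R (y - y')"
  proof -
    have "(\<Sum>i<n. s i *\<^sub>R u i) = (1 / 2) *\<^sub>R ((\<Sum>i<n. l i *\<^sub>R u i) + (\<Sum>i<n. k i *\<^sub>R u i))"
      unfolding sum.distrib[symmetric] scaleR_sum_right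
      by (intro sum.cong refl) (simp add: s_def algebra_simps add_divide_distrib)
    then show ?thesis by (simp add: k l)
  qed
  define E where "E = (\<Sum>i<n. \<bar>s i\<bar> powr q)"
  have E0: "E \<ge> 0" by (simp add: E_def sum_nonneg)
  have rM: "r \<le> M * E powr (1 / q)"
  proof -
    have "r = w \<bullet> (\<Sum>i<n. s i *\<^sub>R u i)" by (simp add: su r_def)
    also have "\<dots> = (\<Sum>i<n. (w \<bullet> u i) * s i)" by (simp add: inner_sum_right mult.commute)
    also have "\<dots> \<le> (\<Sum>i<n. \<bar>w \<bullet> u i\<bar> powr p) powr (1 / p) * E powr (1 / q)"
      unfolding E_def using p pq by (intro Holder_sum) auto
    also have "(\<Sum>i<n. \<bar>w \<bullet> u i\<bar> powr p) powr (1 / p) = M"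
      using pos p by (simp add: powr_powr M_def flip: h)
    finally show ?thesis .
  qed
  have conj: "p / q = p - 1"
    using p by (simp add: q_def)
  have rE: "r powr p / M powr p \<le> E powr (p - 1)"
  proof -
    have "r powr p \<le> (M * E powr (1 / q)) powr p"
      using rM pos p by (intro powr_mono2) auto
    also have "\<dots> = M powr p * E powr (p - 1)"
      using pos by (simp add: powr_mult powr_powr conj)
    finally show ?thesis using pos by (simp add: divide_le_eq mult.commute)
  qed
  define a where "a = (\<Sum>i<n. s i * spow (q - 1) (l i))"
  define b where "b = (\<Sum>i<n. s i * spow (q - 1) (k i))"
  have a: "a \<ge> 0"
    unfolding a_def s_def using pq l k by (intro dual_pairing_nonneg) auto
  have b: "b \<ge> 0"
    using dual_pairing_nonneg[of q k "{..<n}" l] pq l k by (simp add: b_def s_def add.commute)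
  have ab: "2 * E powr (p - 1) \<le> a powr (p - 1) + b powr (p - 1)"
    unfolding a_def b_def E_def s_def using p pq l k by (intro dual_pairings_ge_midpoint) auto
  define Ka where "Ka = g powr p * a powr (p - 1) * r powr (1 - p) / p - \<eta> / 2"
  define Kb where "Kb = g powr p * b powr (p - 1) * r powr (1 - p) / p - \<eta> / 2"
  have KK: "2 * r * g powr p / (p * M powr p) - \<eta> \<le> Ka + Kb"
  proof -
    have rr: "r powr (1 - p) * r powr p = r"
      using pos by (simp flip: powr_add)
    have "2 * r * g powr p / (p * M powr p)
        = g powr p / p * r powr (1 - p) * (2 * (r powr p / M powr p))"
      using rr by (simp add: mult_ac)
    also have "\<dots> \<le> g powr p / p * r powr (1 - p) * (a powr (p - 1) + b powr (p - 1))"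
      using rE ab p by (intro mult_left_mono) auto
    finally show ?thesis
      by (simp add: Ka_def Kb_def distrib_left mult_ac add_divide_distrib)
  qed
  have "\<forall>\<^sub>F \<epsilon> in at_right 0. \<exists>\<zeta> \<nu>. (\<Sum>i<n. \<bar>l i - \<zeta> * s i\<bar> powr q) + \<bar>\<nu>\<bar> powr q \<le> 1
      \<and> \<epsilon> * Ka \<le> \<nu> * \<epsilon> powr (1 / p) * g - \<zeta> * r"
    using p pq l a pos \<eta> by (intro perturbation_gain[where A = a]) (auto simp: Ka_def a_def)
  moreover have "\<forall>\<^sub>F \<epsilon> in at_right 0. \<exists>\<zeta> \<nu>. (\<Sum>i<n. \<bar>k i - \<zeta> * s i\<bar> powr q) + \<bar>\<nu>\<bar> powr q \<le> 1
      \<and> \<epsilon> * Kb \<le> \<nu> * \<epsilon> powr (1 / p) * g - \<zeta> * r"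
    using p pq k b pos \<eta> by (intro perturbation_gain[where A = b]) (auto simp: Kb_def b_def)
  moreover have "\<forall>\<^sub>F \<epsilon> in at_right (0::real). \<epsilon> > 0"
    by (simp add: eventually_at_right_less)
  ultimately show ?thesis
  proof eventually_elim
    case (elim \<epsilon>)
    define V where "V = \<epsilon> powr (1 / p) *\<^sub>R v"
    have V: "w \<bullet> V = \<epsilon> powr (1 / p) * g" "c \<bullet> V = 0" by (simp_all add: V_def g_def v)
    obtain \<zeta> \<nu> where 1: "(\<Sum>i<n. \<bar>l i - \<zeta> * s i\<bar> powr q) + \<bar>\<nu>\<bar> powr q \<le> 1"
      "\<epsilon> * Ka \<le> \<nu> * \<epsilon> powr (1 / p) * g - \<zeta> * r"
      using elim(1) by blast
    obtain \<zeta>' \<nu>' where 2: "(\<Sum>i<n. \<bar>k i - \<zeta>' * s i\<bar> powr q) + \<bar>\<nu>'\<bar> powr q \<le> 1"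
      "\<epsilon> * Kb \<le> \<nu>' * \<epsilon> powr (1 / p) * g - \<zeta>' * r"
      using elim(2) by blast
    define Y where "Y = (\<Sum>i<n. (l i - \<zeta> * s i) *\<^sub>R u i) + \<nu> *\<^sub>R V"
    define Y' where "Y' = (\<Sum>i<n. (\<zeta>' * s i - k i) *\<^sub>R u i) + (- \<nu>') *\<^sub>R V"
    have "Y \<in> lp_sum p A (closed_segment (- V) V)"
      unfolding Y_def using p pq Ac h 1 by (intro combination_in_lp_sum_segment[where q = q]) auto
    moreover have "Y' \<in> lp_sum p A (closed_segment (- V) V)"
      unfolding Y'_def using p pq Ac h 2
      by (intro combination_in_lp_sum_segment[where q = q]) (auto simp: abs_minus_commute)
    moreover have Y: "Y = y - (\<zeta> / 2) *\<^sub>R (y - y') + \<nu> *\<^sub>R V"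
    proof -
      have "(\<Sum>i<n. (l i - \<zeta> * s i) *\<^sub>R u i) = y - \<zeta> *\<^sub>R (\<Sum>i<n. s i *\<^sub>R u i)"
        unfolding l(2) scaleR_sum_right sum_subtractf[symmetric]
        by (intro sum.cong refl) (simp add: scaleR_left_diff_distrib)
      then show ?thesis by (simp add: Y_def su)
    qed
    moreover have Y': "Y' = y' + (\<zeta>' / 2) *\<^sub>R (y - y') - \<nu>' *\<^sub>R V"
    proof -
      have "(\<Sum>i<n. (\<zeta>' * s i - k i) *\<^sub>R u i) = \<zeta>' *\<^sub>R (\<Sum>i<n. s i *\<^sub>R u i) - (\<Sum>i<n. k i *\<^sub>R u i)"
        unfolding scaleR_sum_right sum_subtractf[symmetric]
        by (intro sum.cong refl) (simp add: scaleR_left_diff_distrib)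
      then show ?thesis by (simp add: Y'_def su k)
    qed
    moreover have "c \<bullet> Y = c \<bullet> y" "c \<bullet> Y' = c \<bullet> y"
      using y(3) V by (simp_all add: Y Y' inner_add_right inner_diff_right)
    moreover have "2 * r + \<epsilon> * (2 * r * g powr p / (p * M powr p) - \<eta>) \<le> w \<bullet> (Y - Y')"
    proof -
      have "w \<bullet> (Y - Y') = 2 * r + (\<nu> * \<epsilon> powr (1 / p) * g - \<zeta> * r) + (\<nu>' * \<epsilon> powr (1 / p) * g - \<zeta>' * r)"
        using V by (simp add: Y Y' r_def inner_add_right inner_diff_right field_simps)
      moreover have "\<epsilon> * (2 * r * g powr p / (p * M powr p) - \<eta>) \<le> \<epsilon> * (Ka + Kb)"
        using KK elim by (intro mult_left_mono) auto
      ultimately show ?thesis using 1 2 by (simp add: distrib_left)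
    qed
    moreover have "2 * r = w \<bullet> (y - y')" by (simp add: r_def)
    ultimately show ?case
      unfolding V_def[symmetric] g_def[symmetric] M_def[symmetric] by metis
  qed
qed

text \<open>The second hypothesis holds in particular if the upper right Dini derivative of \<open>f\<close> is nonnegative
on \<open>{a..<b}\<close>. The proof takes the supremum of the points at which the line of slope \<open>- e\<close> through
\<open>(a, f a)\<close> lies below \<open>f\<close>; the first hypothesis puts this supremum into the set.\<close>

lemma Dini_nondecreasing:
  fixes f :: "real \<Rightarrow> real"
  assumes ab: "a \<le> b"
    and left: "\<And>s e. a < s \<Longrightarrow> s \<le> b \<Longrightarrow> 0 < e \<Longrightarrow> \<exists>\<delta>>0. \<forall>t. a \<le> t \<and> s - \<delta> < t \<and> t \<le> s \<longrightarrow> f t \<le> f s + e"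
    and right: "\<And>s e. a \<le> s \<Longrightarrow> s < b \<Longrightarrow> 0 < e \<Longrightarrow> \<exists>t. s < t \<and> t \<le> b \<and> f s - e * (t - s) \<le> f t"
  shows "f a \<le> f b"
proof -
  have *: "f a - e * (b - a) \<le> f b" if e: "e > 0" for e
  proof -
    define T where "T = {t \<in> {a..b}. f a - e * (t - a) \<le> f t}"
    have aT: "a \<in> T" using ab by (simp add: T_def)
    have bdd: "bdd_above T" by (auto simp: T_def bdd_above_def)
    define s where "s = Sup T"
    have sup: "t \<le> s" if "t \<in> T" for t unfolding s_def using that bdd by (rule cSup_upper)
    have s: "a \<le> s" "s \<le> b"
      using sup[OF aT] aT by (auto simp: s_def T_def intro!: cSup_least)
    have "f a - e * (s - a) \<le> f s"
    proof (rule field_le_epsilon)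
      fix d :: real assume d: "d > 0"
      show "f a - e * (s - a) \<le> f s + d"
      proof (cases "a = s")
        case False
        then obtain \<delta> where \<delta>: "\<delta> > 0" "\<And>t. a \<le> t \<Longrightarrow> s - \<delta> < t \<Longrightarrow> t \<le> s \<Longrightarrow> f t \<le> f s + d"
          using left[of s d] s d by auto
        obtain t where t: "t \<in> T" "s - \<delta> < t"
          using less_cSupD[of T "s - \<delta>"] aT \<delta> by (auto simp: s_def)
        have "f a - e * (s - a) \<le> f a - e * (t - a)"
          using e sup[OF t(1)] by simp
        also have "\<dots> \<le> f t" using t by (simp add: T_def)
        also have "\<dots> \<le> f s + d" using \<delta> t sup[OF t(1)] by (auto simp: T_def)
        finally show ?thesis .
      qed (use d in simp)
    qed
    moreover have "s = b"
    proof (rule ccontr)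
      assume "s \<noteq> b"
      then obtain t where t: "s < t" "t \<le> b" "f s - e * (t - s) \<le> f t"
        using right[of s e] s e by auto
      have "f a - e * (t - a) \<le> f t"
        using t(3) \<open>f a - e * (s - a) \<le> f s\<close> by (simp add: algebra_simps)
      then have "t \<in> T" using t s by (simp add: T_def)
      with sup t show False by fastforce
    qed
    ultimately show ?thesis by simp
  qed
  show ?thesis
  proof (rule field_le_epsilon)
    fix d :: real assume d: "d > 0"
    define e where "e = d / (b - a + 1)"
    have e: "e > 0" using ab d by (simp add: e_def)
    have "e * (b - a) \<le> e * (b - a + 1)" using e by simp
    also have "\<dots> = d" using ab by (simp add: e_def)
    finally show "f a \<le> f b + d" using *[OF e] by simp
  qed
qed

lemma lp_sum_superset:
  fixes K L :: "'a::euclidean_space set"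
  assumes p: "p \<ge> 1" and K: "convex_body K" "0 \<in> K" and L: "convex_body L" "0 \<in> L"
  shows "K \<subseteq> lp_sum p K L"
proof (rule support_fun_le_imp_subset[OF K(1) lp_sum_props(1)[OF assms]])
  fix x
  have "support_fun K x = (support_fun K x powr p) powr (1 / p)"
    using p support_fun_nonneg[OF K, of x] by (simp add: powr_powr)
  also have "\<dots> \<le> support_fun (lp_sum p K L) x"
    unfolding support_fun_lp_sum[OF assms] using p by (intro powr_mono2) auto
  finally show "support_fun K x \<le> support_fun (lp_sum p K L) x" .
qed

lemma lp_zonotope_support_fun_minus:
  assumes "lp_zonotope p A" "p \<ge> 1"
  shows "support_fun A (- x) = support_fun A x"
  using assms(1)
proof (induction rule: lp_zonotope.induct)
  case (sum Z v)
  then show ?case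
    using lp_zonotope_convex_body[OF sum.hyps assms(2)] assms(2)
    by (simp add: support_fun_lp_sum segment_convex_body support_fun_segment)
qed (simp add: support_fun_segment)

text \<open>Chords parallel to \<open>v\<close> grow under the addition of \<open>[- v, v]\<close> at least as fast as the
support function in the direction \<open>w\<close>. For \<open>p = 1\<close> both endpoints of the chord move by \<open>v\<close>, and symmetry
bounds the chord by twice the support value. For \<open>p > 1\<close> the segment is added gradually: the longest
chord \<open>G t\<close> on the given line in the \<open>L\<^sub>p\<close>-sum with \<open>t powr (1 / p)\<close> times the segment is
compared with the support value \<open>L t powr (1 / p)\<close> of that body, and their ratio is nondecreasing.\<close>

lemma lp_zonotope_chord_growth:
  fixes A :: "'a::euclidean_space set"
  assumes p: "1 \<le> p" "p \<le> 2" and A: "lp_zonotope p A"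
    and y: "y \<in> A" "y' \<in> A" "c \<bullet> y = c \<bullet> y'"
    and m: "support_fun A w > 0" and v: "w \<bullet> v > 0" "c \<bullet> v = 0"
  shows "\<exists>Y \<in> lp_sum p A (closed_segment (- v) v). \<exists>Y' \<in> lp_sum p A (closed_segment (- v) v).
    c \<bullet> Y = c \<bullet> y \<and> c \<bullet> Y' = c \<bullet> y \<and>
    (1 + (w \<bullet> v / support_fun A w) powr p) powr (1 / p) * (w \<bullet> (y - y')) \<le> w \<bullet> (Y - Y')"
proof -
  have Ac: "convex_body A" "0 \<in> A" using lp_zonotope_convex_body[OF A p(1)] by auto
  consider "w \<bullet> (y - y') \<le> 0" | "p = 1" | "w \<bullet> (y - y') > 0" "p > 1" using p by linarith
  then show ?thesis
  proof cases
    case 1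
    have "y \<in> lp_sum p A (closed_segment (- v) v)"
      using lp_sum_superset[OF p(1) Ac segment_convex_body] y by blast
    moreover have "(1 + (w \<bullet> v / support_fun A w) powr p) powr (1 / p) * (w \<bullet> (y - y')) \<le> w \<bullet> (y - y)"
      using 1 by (simp add: mult_nonneg_nonpos)
    ultimately show ?thesis by blast
  next
    case 2
    have mem: "z + t *\<^sub>R v \<in> lp_sum p A (closed_segment (- v) v)" if "z \<in> A" "\<bar>t\<bar> = 1" for z t
    proof (rule support_fun_le_imp_mem[OF lp_sum_props(1)[OF p(1) Ac segment_convex_body]])
      fix x
      have "x \<bullet> z \<le> support_fun A x" using Ac(1) that(1) by (rule support_fun_upper)
      moreover have "t * (x \<bullet> v) \<le> \<bar>x \<bullet> v\<bar>"
        using abs_ge_self[of "t * (x \<bullet> v)"] that by (simp add: abs_mult)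
      ultimately show "x \<bullet> (z + t *\<^sub>R v) \<le> support_fun (lp_sum p A (closed_segment (- v) v)) x"
        using support_fun_nonneg[OF Ac, of x] support_fun_lp_sum[OF p(1) Ac segment_convex_body, of v x]
        by (simp add: support_fun_segment 2 inner_add_right)
    qed
    have "w \<bullet> y \<le> support_fun A w" "(- w) \<bullet> y' \<le> support_fun A (- w)"
      by (rule support_fun_upper[OF Ac(1) y(1)], rule support_fun_upper[OF Ac(1) y(2)])
    then have "w \<bullet> (y - y') \<le> 2 * support_fun A w"
      using lp_zonotope_support_fun_minus[OF A p(1), of w] by (simp add: inner_diff_right)
    then have "w \<bullet> v / support_fun A w * (w \<bullet> (y - y')) \<le> w \<bullet> v / support_fun A w * (2 * support_fun A w)"
      using v m by (intro mult_left_mono) auto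
    then have "(1 + (w \<bullet> v / support_fun A w) powr p) powr (1 / p) * (w \<bullet> (y - y'))
        \<le> w \<bullet> ((y + 1 *\<^sub>R v) - (y' + (- 1) *\<^sub>R v))"
      using m v 2 by (simp add: inner_add_right inner_diff_right distrib_right)
    moreover have "c \<bullet> (y + 1 *\<^sub>R v) = c \<bullet> y" "c \<bullet> (y' + (- 1) *\<^sub>R v) = c \<bullet> y"
      using v y by (simp_all add: inner_diff_right inner_add_right)
    ultimately show ?thesis using mem[OF y(1), of 1] mem[OF y(2), of "- 1"] by fastforce
  next
    case 3
    define seg where "seg t = closed_segment (- (t powr (1 / p) *\<^sub>R v)) (t powr (1 / p) *\<^sub>R v)" for t
    define B where "B t = lp_sum p A (seg t)" for t
    define g where "g = w \<bullet> v"
    define L where "L t = support_fun A w powr p + t * g powr p" for t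
    have g: "g > 0" using v by (simp add: g_def)
    have L: "L t > 0" if "t \<ge> 0" for t
      using that m by (simp add: L_def add_pos_nonneg)
    have segc: "convex_body (seg t)" "0 \<in> seg t" for t
      by (simp_all add: seg_def segment_convex_body)
    have hseg: "support_fun (seg t) x powr p = t * \<bar>x \<bullet> v\<bar> powr p" if "t \<ge> 0" for t x
      using that p by (simp add: seg_def support_fun_segment abs_mult powr_mult powr_powr)
    have Bz: "lp_zonotope p (B t)" for t
      unfolding B_def seg_def using A by (rule lp_zonotope.sum)
    have Bc: "convex_body (B t)" "0 \<in> B t" for t
      using lp_zonotope_convex_body[OF Bz p(1)] by auto
    have hB: "support_fun (B t) x powr p = support_fun A x powr p + t * \<bar>x \<bullet> v\<bar> powr p" if "t \<ge> 0" for t x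
      unfolding B_def lp_sum_props(3)[OF p(1) Ac segc] using that by (simp add: hseg)
    have hB': "support_fun (B t) x = (support_fun A x powr p + t * \<bar>x \<bullet> v\<bar> powr p) powr (1 / p)"
      if "t \<ge> 0" for t x
      unfolding hB[OF that, symmetric] using p support_fun_nonneg[OF Bc, of t x] by (simp add: powr_powr)
    have mono: "B s \<subseteq> B t" if "0 \<le> s" "s \<le> t" for s t
    proof (rule support_fun_le_imp_subset[OF Bc(1) Bc(1)])
      fix x show "support_fun (B s) x \<le> support_fun (B t) x"
        using that p by (simp add: hB') (intro powr_mono2 add_left_mono mult_right_mono, auto)
    qed
    have AB: "A \<subseteq> B t" for t
      unfolding B_def using lp_sum_superset[OF p(1) Ac segc] .
    have semi: "lp_sum p (B s) (seg t) = B (s + t)" if "0 \<le> s" "0 \<le> t" for s t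
      using that by (intro lp_sum_eqI p Bc segc) (simp add: hB hseg distrib_right)
    define S where "S t = B t \<inter> {x. c \<bullet> x = c \<bullet> y}" for t
    have S: "convex_body (S t)" for t
    proof -
      have "y \<in> S t" using y AB by (auto simp: S_def)
      moreover have "compact (S t)" "convex (S t)"
        unfolding S_def using Bc(1)[of t]
        by (auto simp: convex_body_def intro!: compact_Int_closed convex_Int closed_hyperplane convex_hyperplane)
      ultimately show ?thesis by (auto simp: convex_body_def)
    qed
    define G where "G t = support_fun (S t) w + support_fun (S t) (- w)" for t
    have G_le: "w \<bullet> (x - x') \<le> G t" if "x \<in> S t" "x' \<in> S t" for x x' t
      using support_fun_upper[OF S that(1), of w] support_fun_upper[OF S that(2), of "- w"]
      by (simp add: G_def inner_diff_right)
    have G_att: "\<exists>x\<in>S t. \<exists>x'\<in>S t. G t = w \<bullet> (x - x')" for t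
    proof -
      obtain x where "x \<in> S t" "support_fun (S t) w = w \<bullet> x"
        using support_fun_attained[OF S] by blast
      moreover obtain x' where "x' \<in> S t" "support_fun (S t) (- w) = - w \<bullet> x'"
        using support_fun_attained[OF S] by blast
      ultimately show ?thesis by (auto simp: G_def inner_diff_right)
    qed
    have G_mono: "G s \<le> G t" if "0 \<le> s" "s \<le> t" for s t
      unfolding G_def using mono[OF that] by (intro add_mono support_fun_mono S) (auto simp: S_def)
    have G_ge: "w \<bullet> (y - y') \<le> G t" for t
      using y AB by (intro G_le) (auto simp: S_def)
    have "G 0 / L 0 powr (1 / p) \<le> G 1 / L 1 powr (1 / p)"
    proof (rule Dini_nondecreasing[where f = "\<lambda>t. G t / L t powr (1 / p)"])
      fix s e :: real assume s: "0 < s" "s \<le> 1" and e: "0 < e"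
      have "((\<lambda>t. G s / L t powr (1 / p)) \<longlongrightarrow> G s / L s powr (1 / p)) (at s)"
        unfolding L_def using L[of s] s by (intro tendsto_intros) (auto simp: L_def)
      then have "\<forall>\<^sub>F t in at s. G s / L t powr (1 / p) < G s / L s powr (1 / p) + e"
        using e by (intro order_tendstoD(2)) auto
      then obtain \<delta> where \<delta>: "\<delta> > 0"
        "\<And>t. t \<noteq> s \<Longrightarrow> dist t s < \<delta> \<Longrightarrow> G s / L t powr (1 / p) < G s / L s powr (1 / p) + e"
        unfolding eventually_at by blast
      have "G t / L t powr (1 / p) \<le> G s / L s powr (1 / p) + e" if t: "0 \<le> t" "s - \<delta> < t" "t \<le> s" for t
      proof -
        have "G t / L t powr (1 / p) \<le> G s / L t powr (1 / p)"
          using G_mono[OF t(1,3)] by (intro divide_right_mono) auto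
        also have "\<dots> \<le> G s / L s powr (1 / p) + e"
          using \<delta>(2)[of t] t e by (cases "t = s") (auto simp: dist_real_def)
        finally show ?thesis .
      qed
      then show "\<exists>\<delta>>0. \<forall>t. 0 \<le> t \<and> s - \<delta> < t \<and> t \<le> s \<longrightarrow>
          G t / L t powr (1 / p) \<le> G s / L s powr (1 / p) + e"
        using \<delta>(1) by blast
    next
      fix s e :: real assume s: "0 \<le> s" "s < 1" and e: "0 < e"
      obtain x x' where x: "x \<in> S s" "x' \<in> S s" "G s = w \<bullet> (x - x')" using G_att by blast
      have Gs: "G s > 0" using G_ge[of s] 3 by linarith
      have hs: "support_fun (B s) w powr p = L s"
        using s g by (simp add: hB L_def g_def)
      have hs0: "support_fun (B s) w > 0"
        using hs L[OF s(1)] support_fun_nonneg[OF Bc, of s w] by (cases "support_fun (B s) w = 0") auto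
      have \<eta>: "e * L s powr (1 / p) > 0" using e L[OF s(1)] by simp
      have "\<forall>\<^sub>F \<epsilon> in at_right 0. \<exists>Y \<in> lp_sum p (B s) (seg \<epsilon>). \<exists>Y' \<in> lp_sum p (B s) (seg \<epsilon>).
        c \<bullet> Y = c \<bullet> x \<and> c \<bullet> Y' = c \<bullet> x \<and>
        w \<bullet> (x - x') + \<epsilon> * (w \<bullet> (x - x') * (w \<bullet> v) powr p / (p * support_fun (B s) w powr p)
          - e * L s powr (1 / p)) \<le> w \<bullet> (Y - Y')"
        unfolding seg_def using 3 p Bz x v hs0 \<eta> Gs
        by (intro chord_growth_infinitesimal) (auto simp: S_def)
      moreover have "\<forall>\<^sub>F \<epsilon> in at_right (0::real). \<epsilon> > 0"
        by (simp add: eventually_at_right_less)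
      moreover have "\<forall>\<^sub>F \<epsilon> in at_right (0::real). \<epsilon> < 1 - s"
        using s by (intro order_tendstoD(2)[OF tendsto_ident_at]) auto
      ultimately have "\<forall>\<^sub>F \<epsilon> in at_right (0::real). s < s + \<epsilon> \<and> s + \<epsilon> \<le> 1 \<and>
        G s / L s powr (1 / p) - e * (s + \<epsilon> - s) \<le> G (s + \<epsilon>) / L (s + \<epsilon>) powr (1 / p)"
      proof eventually_elim
        case (elim \<epsilon>)
        define X where "X = g powr p / (p * L s)"
        have X: "X \<ge> 0" using L[OF s(1)] p by (simp add: X_def)
        obtain Y Y' where Y: "Y \<in> B (s + \<epsilon>)" "Y' \<in> B (s + \<epsilon>)" "c \<bullet> Y = c \<bullet> x" "c \<bullet> Y' = c \<bullet> x"
          "G s + \<epsilon> * (G s * X - e * L s powr (1 / p)) \<le> w \<bullet> (Y - Y')"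
          using elim(1) semi[of s \<epsilon>] s elim(2) x(3) by (auto simp: X_def hs g_def)
        have "w \<bullet> (Y - Y') \<le> G (s + \<epsilon>)"
          using Y x by (intro G_le) (auto simp: S_def)
        with Y have GG: "G s * (1 + \<epsilon> * X) - \<epsilon> * (e * L s powr (1 / p)) \<le> G (s + \<epsilon>)"
          by (simp add: algebra_simps)
        \<comment> \<open>Bernoulli: the support value grows at most at its initial rate.\<close>
        have LL: "L (s + \<epsilon>) powr (1 / p) \<le> L s powr (1 / p) * (1 + \<epsilon> * X)"
        proof -
          have "1 + p * (\<epsilon> * X) \<le> (1 + \<epsilon> * X) powr p"
            using abs_powr_tangent[of p 1 "1 + \<epsilon> * X"] p X elim(2) by (simp add: spow_nonneg)
          then have "L s * (1 + p * (\<epsilon> * X)) \<le> L s * (1 + \<epsilon> * X) powr p"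
            using L[OF s(1)] by (intro mult_left_mono) auto
          moreover have "L s * (1 + p * (\<epsilon> * X)) = L (s + \<epsilon>)"
          proof -
            have "L s * (p * X) = g powr p" using L[OF s(1)] p by (simp add: X_def)
            moreover have "L s * (1 + p * (\<epsilon> * X)) = L s + \<epsilon> * (L s * (p * X))"
              by (simp add: distrib_left mult_ac)
            ultimately have "L s * (1 + p * (\<epsilon> * X)) = L s + \<epsilon> * g powr p"
              by (simp only:)
            then show ?thesis by (simp add: L_def distrib_right)
          qed
          ultimately have "L (s + \<epsilon>) powr (1 / p) \<le> (L s * (1 + \<epsilon> * X) powr p) powr (1 / p)"
            using L[of "s + \<epsilon>"] s elim(2) p by (intro powr_mono2) auto
          also have "\<dots> = L s powr (1 / p) * (1 + \<epsilon> * X)"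
            using L[OF s(1)] X elim(2) p by (simp add: powr_mult powr_powr)
          finally show ?thesis .
        qed
        have pos: "L s powr (1 / p) > 0" "L (s + \<epsilon>) powr (1 / p) > 0"
          using L[OF s(1)] L[of "s + \<epsilon>"] s elim(2) by auto
        have Lmono: "L s powr (1 / p) \<le> L (s + \<epsilon>) powr (1 / p)"
          using L[OF s(1)] p elim(2) by (intro powr_mono2) (auto simp: L_def intro: mult_right_mono)
        have "(G s / L s powr (1 / p) - e * \<epsilon>) * L (s + \<epsilon>) powr (1 / p)
            = G s / L s powr (1 / p) * L (s + \<epsilon>) powr (1 / p) - e * \<epsilon> * L (s + \<epsilon>) powr (1 / p)"
          by (simp add: left_diff_distrib)
        also have "\<dots> \<le> G s / L s powr (1 / p) * (L s powr (1 / p) * (1 + \<epsilon> * X)) - e * \<epsilon> * L s powr (1 / p)"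
          using LL Lmono Gs pos e elim(2) by (intro diff_mono mult_left_mono) auto
        also have "\<dots> \<le> G (s + \<epsilon>)"
          using GG pos by (simp add: mult_ac)
        finally have "G s / L s powr (1 / p) - e * \<epsilon> \<le> G (s + \<epsilon>) / L (s + \<epsilon>) powr (1 / p)"
          using pos by (simp add: pos_le_divide_eq)
        then show ?case using elim(2,3) by simp
      qed
      then obtain \<epsilon> where "s < s + \<epsilon> \<and> s + \<epsilon> \<le> 1 \<and>
        G s / L s powr (1 / p) - e * (s + \<epsilon> - s) \<le> G (s + \<epsilon>) / L (s + \<epsilon>) powr (1 / p)"
        using eventually_happens'[OF trivial_limit_at_right_real] by blast
      then show "\<exists>t. s < t \<and> t \<le> 1 \<and> G s / L s powr (1 / p) - e * (t - s) \<le> G t / L t powr (1 / p)"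
        by blast
    qed simp
    then have "L 1 powr (1 / p) / L 0 powr (1 / p) * G 0 \<le> G 1"
      using L[of 0] L[of 1] by (simp add: field_simps)
    moreover have "L 1 powr (1 / p) / L 0 powr (1 / p) = (1 + (w \<bullet> v / support_fun A w) powr p) powr (1 / p)"
      using m L[of 0] L[of 1] g by (simp add: L_def g_def powr_divide add_divide_distrib flip: powr_divide)
    moreover have "w \<bullet> (y - y') \<le> G 0" by (rule G_ge)
    ultimately have "(1 + (w \<bullet> v / support_fun A w) powr p) powr (1 / p) * (w \<bullet> (y - y')) \<le> G 1"
      by (metis mult_left_mono order_trans powr_ge_zero)
    moreover have "seg 1 = closed_segment (- v) v" by (simp add: seg_def)
    moreover obtain x x' where "x \<in> S 1" "x' \<in> S 1" "G 1 = w \<bullet> (x - x')" using G_att by blast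
    ultimately show ?thesis by (intro bexI[of _ x] bexI[of _ x']) (auto simp: S_def B_def)
  qed
qed

section \<open>Area\<close>

text \<open>Identifies the plane with a product of two lines, to make Fubini's theorem available.\<close>

lemma lborel_real2_eq_distr:
  "(lborel :: (real^2) measure) = distr (lborel \<Otimes>\<^sub>M lborel) borel (\<lambda>(t, z). vector [t, z])"
  (is "_ = distr _ _ ?\<phi>")
proof (rule lborel_eqI)
  have \<phi>: "?\<phi> = (\<lambda>x. fst x *\<^sub>R axis 1 1 + snd x *\<^sub>R axis 2 1)"
    by (auto simp: fun_eq_iff vec_eq_iff forall_2 axis_def)
  have "?\<phi> \<in> borel_measurable borel"
    unfolding \<phi> by (intro borel_measurable_continuous_onI continuous_intros)
  then have meas: "?\<phi> \<in> borel_measurable (lborel \<Otimes>\<^sub>M lborel)"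
    by (simp add: lborel_prod)
  fix l u :: "real^2" assume le: "\<And>b. b \<in> Basis \<Longrightarrow> l \<bullet> b \<le> u \<bullet> b"
  have B: "(Basis :: (real^2) set) = {axis 1 1, axis 2 1}"
    by (auto simp: Basis_vec_def UNIV_2)
  have "axis 1 1 \<noteq> (axis 2 1 :: real^2)" by (simp add: axis_eq_axis)
  then have prod: "(\<Prod>b\<in>Basis. (u - l) \<bullet> b) = (u $ 1 - l $ 1) * (u $ 2 - l $ 2)"
    unfolding B by (simp add: inner_axis)
  have le': "l $ 1 \<le> u $ 1" "l $ 2 \<le> u $ 2"
    using le[of "axis 1 1"] le[of "axis 2 1"] by (auto simp: B inner_axis)
  have pre: "?\<phi> -` box l u \<inter> space (lborel \<Otimes>\<^sub>M lborel) = {l $ 1<..<u $ 1} \<times> {l $ 2<..<u $ 2}"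
    by (auto simp: mem_box_cart forall_2 space_pair_measure)
  have "emeasure (distr (lborel \<Otimes>\<^sub>M lborel) borel ?\<phi>) (box l u)
      = emeasure (lborel \<Otimes>\<^sub>M lborel) ({l $ 1<..<u $ 1} \<times> {l $ 2<..<u $ 2})"
    using meas by (subst emeasure_distr) (auto simp: pre)
  also have "\<dots> = ennreal (u $ 1 - l $ 1) * ennreal (u $ 2 - l $ 2)"
    using le' by (subst lborel.emeasure_pair_measure_Times) auto
  also have "\<dots> = (\<Prod>b\<in>Basis. (u - l) \<bullet> b)"
    using le' by (simp add: prod ennreal_mult)
  finally show "emeasure (distr (lborel \<Otimes>\<^sub>M lborel) borel ?\<phi>) (box l u) = (\<Prod>b\<in>Basis. (u - l) \<bullet> b)" .
qed simp

lemma emeasure_real2_slices: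
  fixes S :: "(real^2) set"
  assumes S: "S \<in> sets borel"
  shows "emeasure lborel S = (\<integral>\<^sup>+z. emeasure lborel {t. vector [t, z] \<in> S} \<partial>lborel)"
    and "(\<lambda>z. emeasure lborel {t. vector [t, z] \<in> S}) \<in> borel_measurable lborel"
proof -
  let ?\<phi> = "\<lambda>(t, z). vector [t, z] :: real^2"
  have \<phi>: "?\<phi> = (\<lambda>x. fst x *\<^sub>R axis 1 1 + snd x *\<^sub>R axis 2 1)"
    by (auto simp: fun_eq_iff vec_eq_iff forall_2 axis_def)
  have "?\<phi> \<in> borel_measurable borel"
    unfolding \<phi> by (intro borel_measurable_continuous_onI continuous_intros)
  then have meas: "?\<phi> \<in> borel_measurable (lborel \<Otimes>\<^sub>M lborel)"
    by (simp add: lborel_prod)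
  have Q: "?\<phi> -` S \<in> sets (lborel \<Otimes>\<^sub>M lborel)"
    using measurable_sets[OF meas, of S] S by (simp add: space_pair_measure)
  have slice: "(\<lambda>t. (t, z)) -` (?\<phi> -` S) = {t. vector [t, z] \<in> S}" for z by auto
  have "emeasure lborel S = emeasure (distr (lborel \<Otimes>\<^sub>M lborel) borel ?\<phi>) S"
    by (simp flip: lborel_real2_eq_distr)
  also have "\<dots> = emeasure (lborel \<Otimes>\<^sub>M lborel) (?\<phi> -` S)"
    using meas S by (subst emeasure_distr) (auto simp: space_pair_measure)
  also have "\<dots> = (\<integral>\<^sup>+z. emeasure lborel {t. vector [t, z] \<in> S} \<partial>lborel)"
    unfolding lborel_pair.emeasure_pair_measure_alt2[OF Q] slice ..
  finally show "emeasure lborel S = (\<integral>\<^sup>+z. emeasure lborel {t. vector [t, z] \<in> S} \<partial>lborel)" .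
  show "(\<lambda>z. emeasure lborel {t. vector [t, z] \<in> S}) \<in> borel_measurable lborel"
    using lborel_pair.measurable_emeasure_Pair2[OF Q] unfolding slice .
qed

text \<open>Integrate the lengths of the chords \<open>c \<bullet> y = z\<close> over \<open>z\<close>, in the linear coordinates
\<open>(w \<bullet> y, c \<bullet> y)\<close>. The common Jacobian cancels.\<close>

lemma area_mono_chords:
  fixes A B :: "(real^2) set" and c w :: "real^2"
  assumes A: "convex_body A" and B: "convex_body B"
    and det: "w $ 1 * c $ 2 - w $ 2 * c $ 1 \<noteq> 0" and \<kappa>: "\<kappa> \<ge> 0"
    and chords: "\<And>y y'. y \<in> A \<Longrightarrow> y' \<in> A \<Longrightarrow> c \<bullet> y = c \<bullet> y' \<Longrightarrow>
      \<exists>Y\<in>B. \<exists>Y'\<in>B. c \<bullet> Y = c \<bullet> y \<and> c \<bullet> Y' = c \<bullet> y \<and> \<kappa> * (w \<bullet> (y - y')) \<le> w \<bullet> (Y - Y')"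
  shows "\<kappa> * measure lebesgue A \<le> measure lebesgue B"
proof -
  define f :: "real^2 \<Rightarrow> real^2" where "f y = vector [w \<bullet> y, c \<bullet> y]" for y
  have f: "linear f"
    by (rule linearI) (simp_all add: f_def vec_eq_iff forall_2 inner_add_right)
  have mat: "matrix f = (\<chi> i j. if i = 1 then w $ j else c $ j)"
    by (auto simp: matrix_def f_def vec_eq_iff forall_2 inner_axis)
  have detf: "\<bar>det (matrix f)\<bar> = \<bar>w $ 1 * c $ 2 - w $ 2 * c $ 1\<bar>"
    by (simp add: mat det_2)
  define D where "D = \<bar>det (matrix f)\<bar>"
  have D: "D > 0" using det by (simp add: D_def detf)
  define sl where "sl K z = {t. vector [t, z] \<in> f ` K}" for K z
  have sl: "sl K z = (\<lambda>y. w \<bullet> y) ` (K \<inter> {y. c \<bullet> y = z})" for K z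
    by (auto simp: sl_def f_def vec_eq_iff forall_2 image_iff)
  have cK: "compact (K \<inter> {y. c \<bullet> y = z})" "convex (K \<inter> {y. c \<bullet> y = z})" if "convex_body K" for K z
    using that
    by (auto simp: convex_body_def intro!: compact_Int_closed convex_Int closed_hyperplane convex_hyperplane)
  have slm: "sl K z \<in> sets lborel" if "convex_body K" for K z
    unfolding sl using cK(1)[OF that, of z]
    by (auto intro!: borel_compact compact_continuous_image continuous_intros)
  have vol: "ennreal (D * measure lebesgue K) = (\<integral>\<^sup>+z. emeasure lborel (sl K z) \<partial>lborel)"
    and mes: "(\<lambda>z. emeasure lborel (sl K z)) \<in> borel_measurable lborel" if "convex_body K" for K
  proof -
    have K: "compact K" using that by (simp add: convex_body_def)
    have fK: "compact (f ` K)"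
      using K f by (intro compact_continuous_image linear_continuous_on) (auto simp: linear_linear)
    have "ennreal (D * measure lebesgue K) = ennreal (measure lebesgue (f ` K))"
      using measure_linear_image[OF f lmeasurable_compact[OF K]] by (simp add: D_def)
    also have "\<dots> = emeasure lebesgue (f ` K)"
      using lmeasurable_compact[OF fK] by (simp add: emeasure_eq_measure2)
    also have "\<dots> = emeasure lborel (f ` K)"
      using fK by (simp add: borel_compact)
    also have "\<dots> = (\<integral>\<^sup>+z. emeasure lborel (sl K z) \<partial>lborel)"
      unfolding sl_def using fK by (intro emeasure_real2_slices borel_compact)
    finally show "ennreal (D * measure lebesgue K) = (\<integral>\<^sup>+z. emeasure lborel (sl K z) \<partial>lborel)" .
    show "(\<lambda>z. emeasure lborel (sl K z)) \<in> borel_measurable lborel"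
      unfolding sl_def using fK by (intro emeasure_real2_slices borel_compact)
  qed
  have slice: "ennreal \<kappa> * emeasure lborel (sl A z) \<le> emeasure lborel (sl B z)" for z
  proof (cases "A \<inter> {y. c \<bullet> y = z} = {}")
    case False
    then have cb: "convex_body (A \<inter> {y. c \<bullet> y = z})"
      using cK[OF A, of z] by (simp add: convex_body_def)
    obtain y where y: "y \<in> A" "c \<bullet> y = z" "support_fun (A \<inter> {y. c \<bullet> y = z}) w = w \<bullet> y"
      using support_fun_attained[OF cb] by blast
    obtain y' where y': "y' \<in> A" "c \<bullet> y' = z" "support_fun (A \<inter> {y. c \<bullet> y = z}) (- w) = - w \<bullet> y'"
      using support_fun_attained[OF cb] by blast
    have sub: "sl A z \<subseteq> {w \<bullet> y'..w \<bullet> y}"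
      using support_fun_upper[OF cb, of _ w] support_fun_upper[OF cb, of _ "- w"] y y'
      by (auto simp: sl)
    have "y' \<in> A \<inter> {y. c \<bullet> y = z}" using y' by simp
    then have yy: "w \<bullet> y' \<le> w \<bullet> y"
      using support_fun_upper[OF cb, of y' w] y by simp
    obtain Y Y' where Y: "Y \<in> B" "Y' \<in> B" "c \<bullet> Y = z" "c \<bullet> Y' = z" "\<kappa> * (w \<bullet> (y - y')) \<le> w \<bullet> (Y - Y')"
      using chords[OF y(1) y'(1)] y y' by auto
    have "0 \<le> \<kappa> * (w \<bullet> (y - y'))"
      using \<kappa> yy by (simp add: inner_diff_right)
    then have YY: "w \<bullet> Y' \<le> w \<bullet> Y"
      using Y(5) by (simp add: inner_diff_right)
    have "{w \<bullet> Y'..w \<bullet> Y} = closed_segment (w \<bullet> Y') (w \<bullet> Y)"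
      using YY by (simp add: closed_segment_eq_real_ivl)
    also have "\<dots> = (\<lambda>y. w \<bullet> y) ` closed_segment Y' Y"
      by (rule closed_segment_linear_image[OF bounded_linear.linear[OF bounded_linear_inner_right]])
    also have "\<dots> \<subseteq> sl B z"
      unfolding sl using Y cK(2)[OF B, of z] by (intro image_mono closed_segment_subset) auto
    finally have sup: "{w \<bullet> Y'..w \<bullet> Y} \<subseteq> sl B z" .
    have "ennreal \<kappa> * emeasure lborel (sl A z) \<le> ennreal \<kappa> * emeasure lborel {w \<bullet> y'..w \<bullet> y}"
      using sub by (intro mult_left_mono emeasure_mono) auto
    also have "\<dots> = ennreal (\<kappa> * (w \<bullet> (y - y')))"
      using yy \<kappa> by (simp add: inner_diff_right ennreal_mult)
    also have "\<dots> \<le> ennreal (w \<bullet> (Y - Y'))"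
      using Y(5) by (rule ennreal_leI)
    also have "\<dots> = emeasure lborel {w \<bullet> Y'..w \<bullet> Y}"
      using YY by (simp add: inner_diff_right)
    also have "\<dots> \<le> emeasure lborel (sl B z)"
      using sup slm[OF B] by (intro emeasure_mono) auto
    finally show ?thesis .
  qed (simp add: sl)
  have "ennreal (\<kappa> * (D * measure lebesgue A)) = ennreal \<kappa> * (\<integral>\<^sup>+z. emeasure lborel (sl A z) \<partial>lborel)"
    using \<kappa> D by (simp add: ennreal_mult vol[OF A, symmetric])
  also have "\<dots> = (\<integral>\<^sup>+z. ennreal \<kappa> * emeasure lborel (sl A z) \<partial>lborel)"
    using mes[OF A] by (simp add: nn_integral_cmult)
  also have "\<dots> \<le> (\<integral>\<^sup>+z. emeasure lborel (sl B z) \<partial>lborel)"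
    using slice by (intro nn_integral_mono) auto
  also have "\<dots> = ennreal (D * measure lebesgue B)"
    by (simp add: vol[OF B])
  finally have "\<kappa> * (D * measure lebesgue A) \<le> D * measure lebesgue B"
    using D by (subst (asm) ennreal_le_iff) auto
  then have "D * (\<kappa> * measure lebesgue A) \<le> D * measure lebesgue B"
    by (simp add: mult_ac)
  then show ?thesis using D by simp
qed

text \<open>The support function of the sum in the direction \<open>w\<close> is exactly \<open>\<kappa>\<close> times that of \<open>A\<close>, and all
chords parallel to \<open>v\<close> grow by the factor \<open>\<kappa>\<close>.\<close>

lemma lp_zonotope_ratio_mono_segment:
  fixes A :: "(real^2) set"
  assumes p: "1 \<le> p" "p \<le> 2" and A: "lp_zonotope p A" and m: "support_fun A w > 0"
  shows "measure lebesgue A * support_fun (lp_sum p A (closed_segment (- v) v)) w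
    \<le> measure lebesgue (lp_sum p A (closed_segment (- v) v)) * support_fun A w"
proof -
  define g where "g = w \<bullet> v"
  define B where "B = lp_sum p A (closed_segment (- v) v)"
  have Ac: "convex_body A" "0 \<in> A" using lp_zonotope_convex_body[OF A p(1)] by auto
  have Bc: "convex_body B" unfolding B_def using lp_sum_props(1)[OF p(1) Ac segment_convex_body] .
  have AB: "A \<subseteq> B" unfolding B_def using lp_sum_superset[OF p(1) Ac segment_convex_body] .
  define \<kappa> where "\<kappa> = (1 + (\<bar>g\<bar> / support_fun A w) powr p) powr (1 / p)"
  have h: "support_fun B w = \<kappa> * support_fun A w"
  proof -
    have "support_fun B w = (support_fun A w powr p * (1 + (\<bar>g\<bar> / support_fun A w) powr p)) powr (1 / p)"
      using m by (simp add: B_def g_def support_fun_lp_sum[OF p(1) Ac segment_convex_body]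
        support_fun_segment distrib_left powr_divide)
    then show ?thesis
      using m p by (simp add: powr_mult powr_powr \<kappa>_def)
  qed
  have "\<kappa> * measure lebesgue A \<le> measure lebesgue B"
  proof (cases "g = 0")
    case True
    then have "\<kappa> = 1" using m p by (simp add: \<kappa>_def)
    moreover have "measure lebesgue A \<le> measure lebesgue B"
      using AB Ac Bc by (intro measure_mono_fmeasurable) (auto simp: convex_body_def lmeasurable_compact fmeasurableD)
    ultimately show ?thesis by simp
  next
    case False
    define v' where "v' = sgn g *\<^sub>R v"
    have v': "w \<bullet> v' = \<bar>g\<bar>" by (simp add: v'_def g_def abs_sgn mult.commute)
    have seg: "closed_segment (- v') v' = closed_segment (- v) v"
      using False by (cases "g > 0") (auto simp: v'_def closed_segment_commute)
    define c where "c = rot90 v'"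
    have c: "c \<bullet> v' = 0" "w $ 1 * c $ 2 - w $ 2 * c $ 1 = \<bar>g\<bar>"
      using v' by (simp_all add: c_def rot90_def inner_vec_def sum_2)
    show ?thesis
    proof (rule area_mono_chords[OF Ac(1) Bc, of w c])
      show "w $ 1 * c $ 2 - w $ 2 * c $ 1 \<noteq> 0" using c False by simp
      show "\<kappa> \<ge> 0" by (simp add: \<kappa>_def)
      fix y y' assume "y \<in> A" "y' \<in> A" "c \<bullet> y = c \<bullet> y'"
      then show "\<exists>Y\<in>B. \<exists>Y'\<in>B. c \<bullet> Y = c \<bullet> y \<and> c \<bullet> Y' = c \<bullet> y \<and> \<kappa> * (w \<bullet> (y - y')) \<le> w \<bullet> (Y - Y')"
        using lp_zonotope_chord_growth[OF p A, of y y' c w v'] m c v' False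
        by (simp add: B_def \<kappa>_def seg)
    qed
  qed
  then have "(\<kappa> * measure lebesgue A) * support_fun A w \<le> measure lebesgue B * support_fun A w"
    using m by (intro mult_right_mono) auto
  then show ?thesis unfolding B_def[symmetric] by (simp add: h mult_ac)
qed

lemma lp_sum_assoc:
  fixes K L M :: "'a::euclidean_space set"
  assumes p: "p \<ge> 1" and K: "convex_body K" "0 \<in> K" and L: "convex_body L" "0 \<in> L"
    and M: "convex_body M" "0 \<in> M"
  shows "lp_sum p K (lp_sum p L M) = lp_sum p (lp_sum p K L) M"
proof -
  note KL = lp_sum_props(1,2)[OF p K L]
  show ?thesis
    by (intro lp_sum_eqI p K lp_sum_props[OF p L M] lp_sum_props(1,2)[OF p KL M])
      (simp add: lp_sum_props(3)[OF p KL M] lp_sum_props(3)[OF p K L] lp_sum_props(3)[OF p L M])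
qed

lemma lp_zonotope_lp_sum:
  fixes A B :: "'a::euclidean_space set"
  assumes p: "p \<ge> 1" and A: "lp_zonotope p A" and B: "lp_zonotope p B"
  shows "lp_zonotope p (lp_sum p A B)"
  using B
proof (induction rule: lp_zonotope.induct)
  case (segment v)
  show ?case using A by (rule lp_zonotope.sum)
next
  case (sum Z v)
  have "lp_zonotope p (lp_sum p (lp_sum p A Z) (closed_segment (- v) v))"
    using sum.IH by (rule lp_zonotope.sum)
  then show ?case
    using lp_zonotope_convex_body[OF A p] lp_zonotope_convex_body[OF sum.hyps p]
    by (simp add: lp_sum_assoc p segment_convex_body)
qed

lemma lp_zonotope_ratio_mono:
  fixes A B :: "(real^2) set"
  assumes p: "1 \<le> p" "p \<le> 2" and A: "lp_zonotope p A" and B: "lp_zonotope p B"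
    and m: "support_fun A w > 0"
  shows "measure lebesgue A * support_fun (lp_sum p A B) w
    \<le> measure lebesgue (lp_sum p A B) * support_fun A w"
  using B
proof (induction rule: lp_zonotope.induct)
  case (segment v)
  show ?case by (rule lp_zonotope_ratio_mono_segment[OF p A m])
next
  case (sum Z v)
  have Ac: "convex_body A" "0 \<in> A" using lp_zonotope_convex_body[OF A p(1)] by auto
  have Zc: "convex_body Z" "0 \<in> Z" using lp_zonotope_convex_body[OF sum.hyps p(1)] by auto
  define C where "C = lp_sum p A Z"
  define D where "D = lp_sum p C (closed_segment (- v) v)"
  have D: "lp_sum p A (lp_sum p Z (closed_segment (- v) v)) = D"
    unfolding D_def C_def by (rule lp_sum_assoc[OF p(1) Ac Zc segment_convex_body])
  have C: "lp_zonotope p C" unfolding C_def using lp_zonotope_lp_sum[OF p(1) A sum.hyps] .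
  have Cc: "convex_body C" "0 \<in> C" using lp_zonotope_convex_body[OF C p(1)] by auto
  have hC: "support_fun C w > 0"
    using m support_fun_mono[OF Ac(1) Cc(1), of w] lp_sum_superset[OF p(1) Ac Zc] by (simp add: C_def)
  have hD: "support_fun D w \<ge> 0"
    using lp_sum_props(1,2)[OF p(1) Cc segment_convex_body] by (simp add: D_def support_fun_nonneg)
  have 1: "measure lebesgue A * support_fun C w \<le> measure lebesgue C * support_fun A w"
    using sum.IH by (simp add: C_def)
  have 2: "measure lebesgue C * support_fun D w \<le> measure lebesgue D * support_fun C w"
    unfolding D_def by (rule lp_zonotope_ratio_mono_segment[OF p C hC])
  have "support_fun C w * (measure lebesgue A * support_fun D w)
      = (measure lebesgue A * support_fun C w) * support_fun D w"
    by simp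
  also have "\<dots> \<le> (measure lebesgue C * support_fun A w) * support_fun D w"
    using 1 hD by (rule mult_right_mono)
  also have "\<dots> = (measure lebesgue C * support_fun D w) * support_fun A w"
    by simp
  also have "\<dots> \<le> (measure lebesgue D * support_fun C w) * support_fun A w"
    using 2 m by (intro mult_right_mono) auto
  also have "\<dots> = support_fun C w * (measure lebesgue D * support_fun A w)"
    by simp
  finally show ?case using hC unfolding D by simp
qed

section \<open>From zonotopes to zonoids\<close>

lemma support_fun_le_hausdorff:
  fixes K L :: "'a::euclidean_space set"
  assumes K: "convex_body K" and L: "convex_body L"
  shows "support_fun K x \<le> support_fun L x + hausdorff_dist K L * norm x"
proof -
  obtain y where y: "y \<in> K" "support_fun K x = x \<bullet> y"
    using support_fun_attained[OF K] by blast
  obtain z where z: "z \<in> L" "infdist y L = dist y z"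
    using infdist_attains_inf[of L y] L by (auto simp: convex_body_def compact_imp_closed)
  have "dist y z \<le> hausdorff_dist K L"
    using infdist_le_hausdorff_dist[of K y L] K y z by (simp add: convex_body_def)
  have "x \<bullet> y = x \<bullet> z + x \<bullet> (y - z)"
    by (simp add: inner_diff_right)
  also have "\<dots> \<le> support_fun L x + norm x * norm (y - z)"
    using support_fun_upper[OF L z(1)] norm_cauchy_schwarz by (intro add_mono)
  also have "\<dots> \<le> support_fun L x + norm x * hausdorff_dist K L"
    using \<open>dist y z \<le> hausdorff_dist K L\<close> by (intro add_left_mono mult_left_mono) (auto simp: dist_norm)
  finally show ?thesis using y by (simp add: mult.commute)
qed

lemma hausdorff_dist_commute: "hausdorff_dist K L = hausdorff_dist L K"
  by (simp add: hausdorff_dist_def max.commute)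

lemma support_fun_tendsto:
  fixes K :: "'a::euclidean_space set"
  assumes K: "convex_body K" and Z: "\<And>n. convex_body (Z n)"
    and lim: "(\<lambda>n. hausdorff_dist (Z n) K) \<longlonglongrightarrow> 0"
  shows "(\<lambda>n. support_fun (Z n) x) \<longlonglongrightarrow> support_fun K x"
proof (rule real_tendsto_sandwich)
  show "\<forall>\<^sub>F n in sequentially. support_fun K x - hausdorff_dist (Z n) K * norm x \<le> support_fun (Z n) x"
    using support_fun_le_hausdorff[OF K Z, of x] by (simp add: hausdorff_dist_commute algebra_simps)
  show "\<forall>\<^sub>F n in sequentially. support_fun (Z n) x \<le> support_fun K x + hausdorff_dist (Z n) K * norm x"
    using support_fun_le_hausdorff[OF Z K, of _ x] by simp
  show "(\<lambda>n. support_fun K x - hausdorff_dist (Z n) K * norm x) \<longlonglongrightarrow> support_fun K x"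
    by (rule tendsto_eq_intros lim | simp)+
  show "(\<lambda>n. support_fun K x + hausdorff_dist (Z n) K * norm x) \<longlonglongrightarrow> support_fun K x"
    by (rule tendsto_eq_intros lim | simp)+
qed

lemma lp_zonoid_support_fun_minus:
  fixes K :: "'a::euclidean_space set"
  assumes K: "lp_zonoid p K" and p: "p \<ge> 1"
  shows "support_fun K (- x) = support_fun K x"
proof -
  obtain Z where Z: "\<And>n. lp_zonotope p (Z n)" "(\<lambda>n. hausdorff_dist (Z n) K) \<longlonglongrightarrow> 0"
    using K unfolding lp_zonoid_def by blast
  have Zc: "convex_body (Z n)" for n using lp_zonotope_convex_body[OF Z(1) p] by blast
  note lim = support_fun_tendsto[OF lp_zonoid_convex_body(1)[OF K p] Zc Z(2)]
  show ?thesis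
    using lim[of "- x"] lim[of x] by (simp add: lp_zonotope_support_fun_minus[OF Z(1) p] LIMSEQ_unique)
qed

text \<open>The triangle inequality for the \<open>\<ell>\<^sub>p\<close>-norm on pairs, through the norming functional.\<close>

lemma lp_norm_add_le:
  fixes S T s t d e p :: real
  assumes p: "p \<ge> 1" and nn: "0 \<le> S" "0 \<le> T" "0 \<le> s" "0 \<le> t" "0 \<le> d" "0 \<le> e"
    and le: "S \<le> s + d" "T \<le> t + e"
  shows "(S powr p + T powr p) powr (1 / p) \<le> (s powr p + t powr p) powr (1 / p) + (d + e)"
proof -
  obtain a b where ab: "(a, b) \<in> lp_coeffs p" "a * S + b * T = (S powr p + T powr p) powr (1 / p)"
    using lp_coeffs_attained[OF p nn(1,2)] by blast
  have ab0: "0 \<le> a" "0 \<le> b" and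
    dual: "\<And>s t. 0 \<le> s \<Longrightarrow> 0 \<le> t \<Longrightarrow> a * s + b * t \<le> (s powr p + t powr p) powr (1 / p)"
    using ab(1) by (auto simp: lp_coeffs_def)
  have ab1: "a \<le> 1" "b \<le> 1" using dual[of 1 0] dual[of 0 1] by auto
  have "a * S + b * T \<le> a * (s + d) + b * (t + e)"
    using ab0 le by (intro add_mono mult_left_mono) auto
  also have "\<dots> = (a * s + b * t) + (a * d + b * e)"
    by (simp add: algebra_simps)
  also have "\<dots> \<le> (s powr p + t powr p) powr (1 / p) + (1 * d + 1 * e)"
    using dual[of s t] ab1 nn by (intro add_mono mult_right_mono) auto
  finally show ?thesis using ab(2) by simp
qed

lemma support_fun_scaleR:
  assumes K: "convex_body K" and t: "t \<ge> 0"
  shows "convex_body ((*\<^sub>R) t ` K)" "support_fun ((*\<^sub>R) t ` K) x = t * support_fun K x"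
proof -
  show cb: "convex_body ((*\<^sub>R) t ` K)"
    using K by (auto simp: convex_body_def compact_scaling convex_scaling)
  obtain y where y: "y \<in> K" "support_fun K x = x \<bullet> y"
    using support_fun_attained[OF K] by blast
  obtain z where z: "z \<in> K" "support_fun ((*\<^sub>R) t ` K) x = x \<bullet> (t *\<^sub>R z)"
    using support_fun_attained[OF cb, of x] by blast
  show "support_fun ((*\<^sub>R) t ` K) x = t * support_fun K x"
  proof (rule antisym)
    show "support_fun ((*\<^sub>R) t ` K) x \<le> t * support_fun K x"
      using support_fun_upper[OF K z(1), of x] t by (simp add: z(2) mult_left_mono)
    show "t * support_fun K x \<le> support_fun ((*\<^sub>R) t ` K) x"
      using support_fun_upper[OF cb imageI[OF y(1)], of x] y by simp
  qed
qed

text \<open>Comparison of areas up to dilation: close bodies with interior points are nested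
after dilation by factors near one, so this gives the semicontinuity of area in both directions.\<close>

lemma area_le_if_support_fun_le:
  fixes K L :: "(real^2) set"
  assumes K: "convex_body K" and L: "convex_body L" and t: "t \<ge> 0" "s \<ge> 0"
    and le: "\<And>x. t * support_fun K x \<le> s * support_fun L x"
  shows "t\<^sup>2 * measure lebesgue K \<le> s\<^sup>2 * measure lebesgue L"
proof -
  have scale: "measure lebesgue ((*\<^sub>R) t ` K) = t\<^sup>2 * measure lebesgue K" if "t \<ge> 0"
    for t and K :: "(real^2) set"
    using measure_lebesgue_affine[of t 0 K] that by simp
  have "(*\<^sub>R) t ` K \<subseteq> (*\<^sub>R) s ` L"
    using le t by (intro support_fun_le_imp_subset support_fun_scaleR(1) K L)
      (simp_all add: support_fun_scaleR(2) K L)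
  then have "measure lebesgue ((*\<^sub>R) t ` K) \<le> measure lebesgue ((*\<^sub>R) s ` L)"
    using support_fun_scaleR(1)[OF K t(1)] support_fun_scaleR(1)[OF L t(2)]
    by (intro measure_mono_fmeasurable) (auto simp: convex_body_def lmeasurable_compact fmeasurableD)
  then show ?thesis unfolding scale[OF t(1)] scale[OF t(2)] .
qed

text \<open>A body of positive volume contains a ball around some point; averaging the bounds for
\<open>x\<close> and \<open>- x\<close> removes the centre of the ball.\<close>

lemma support_fun_ge_norm:
  fixes K :: "'a::euclidean_space set"
  assumes K: "convex_body K" and sym: "\<And>x. support_fun K (- x) = support_fun K x"
    and pos: "measure lebesgue K > 0"
  obtains r where "r > 0" "\<And>x. r * norm x \<le> support_fun K x"
proof -
  have "\<not> negligible K"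
    using pos negligible_imp_measure0[of K] by linarith
  then have "interior K \<noteq> {}"
    using K by (simp add: negligible_convex_interior convex_body_def)
  then obtain a where "a \<in> interior K" by blast
  then obtain e where a: "e > 0" "cball a e \<subseteq> K"
    unfolding mem_interior_cball by blast
  have "e * norm x \<le> support_fun K x" for x
  proof (cases "x = 0")
    case True
    have "a \<in> K" using a by auto
    then show ?thesis using True support_fun_upper[OF K, of a 0] by simp
  next
    case False
    define z where "z = (e / norm x) *\<^sub>R x"
    have z: "norm z = e" "x \<bullet> z = e * norm x"
      using False a by (simp_all add: z_def dot_square_norm power2_eq_square)
    have "a + z \<in> K" "a - z \<in> K" using a z by (auto simp: dist_norm)
    then have "x \<bullet> (a + z) \<le> support_fun K x" "(- x) \<bullet> (a - z) \<le> support_fun K (- x)"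
      using support_fun_upper[OF K] by blast+
    then show ?thesis using z sym[of x] by (simp add: inner_add_right inner_diff_right)
  qed
  with a(1) show thesis by (rule that)
qed

lemma perp_line_length_proj:
  fixes K :: "(real^2) set"
  assumes u: "norm u = 1" and K: "convex_body K"
  shows "perp_line_length u (proj_perp u ` K) = support_fun K (rot90 u) + support_fun K (- rot90 u)"
proof -
  define w where "w = rot90 u"
  have w: "w \<bullet> w = 1" "w \<bullet> u = 0" "u \<bullet> u = 1" "w \<noteq> 0"
    using rot90_orthonormal[OF u] u by (auto simp: w_def norm_eq_1 inner_commute)
  have proj: "proj_perp u y = (w \<bullet> y) *\<^sub>R w" for y
  proof -
    have "u \<bullet> proj_perp u y = 0"
      by (simp add: proj_perp_def inner_diff_right w inner_commute)
    then obtain t where t: "proj_perp u y = t *\<^sub>R w"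
      using perp_line_eq_range[OF u] by (auto simp: w_def)
    have "t = w \<bullet> proj_perp u y" by (simp add: t w)
    also have "\<dots> = w \<bullet> y" by (simp add: proj_perp_def inner_diff_right w)
    finally show ?thesis using t by simp
  qed
  obtain y where y: "y \<in> K" "support_fun K w = w \<bullet> y" using support_fun_attained[OF K] by blast
  obtain z where z: "z \<in> K" "support_fun K (- w) = - w \<bullet> z" using support_fun_attained[OF K] by blast
  have "{t. t *\<^sub>R w \<in> proj_perp u ` K} = (\<lambda>y. w \<bullet> y) ` K"
    using w by (auto simp: proj image_iff)
  also have "\<dots> = {w \<bullet> z..w \<bullet> y}"
  proof
    show "(\<lambda>y. w \<bullet> y) ` K \<subseteq> {w \<bullet> z..w \<bullet> y}"
      using support_fun_upper[OF K, of _ w] support_fun_upper[OF K, of _ "- w"] y z by auto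
    have "w \<bullet> z \<le> w \<bullet> y" using support_fun_upper[OF K z(1), of w] y by simp
    then have "{w \<bullet> z..w \<bullet> y} = closed_segment (w \<bullet> z) (w \<bullet> y)"
      by (simp add: closed_segment_eq_real_ivl)
    also have "\<dots> = (\<lambda>y. w \<bullet> y) ` closed_segment z y"
      by (rule closed_segment_linear_image[OF bounded_linear.linear[OF bounded_linear_inner_right]])
    also have "\<dots> \<subseteq> (\<lambda>y. w \<bullet> y) ` K"
      using K y z by (intro image_mono closed_segment_subset) (auto simp: convex_body_def)
    finally show "{w \<bullet> z..w \<bullet> y} \<subseteq> (\<lambda>y. w \<bullet> y) ` K" .
  qed
  finally have "perp_line_length u (proj_perp u ` K) = measure lebesgue {w \<bullet> z..w \<bullet> y}"
    by (simp add: perp_line_length_def w_def)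
  moreover have "w \<bullet> z \<le> w \<bullet> y" using support_fun_upper[OF K z(1), of w] y by simp
  ultimately show ?thesis using y z by (simp add: w_def)
qed

text \<open>Approximate both bodies by zonotopes. If \<open>A\<close> has positive area, the error terms
are bounded by a multiple of its support function, so the approximants of \<open>A\<close> contain
\<open>t n\<close> times \<open>A\<close>, and the approximants of the sum lie in \<open>s n\<close> times the sum, with
\<open>t n\<close> and \<open>s n\<close> tending to one.\<close>

lemma lp_zonoid_ratio_mono:
  fixes A B :: "(real^2) set"
  assumes p: "1 \<le> p" "p \<le> 2" and A: "lp_zonoid p A" and B: "lp_zonoid p B"
    and m: "support_fun A w > 0"
  shows "measure lebesgue A * support_fun (lp_sum p A B) w
    \<le> measure lebesgue (lp_sum p A B) * support_fun A w"
proof (cases "measure lebesgue A = 0")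
  case True
  then show ?thesis using m by simp
next
  case False
  note Ac = lp_zonoid_convex_body[OF A p(1)] and Bc = lp_zonoid_convex_body[OF B p(1)]
  define C where "C = lp_sum p A B"
  have Cc: "convex_body C" "0 \<in> C" unfolding C_def using lp_sum_props(1,2)[OF p(1) Ac Bc] .
  have hAC: "support_fun A x \<le> support_fun C x" for x
    using support_fun_mono[OF Ac(1) Cc(1)] lp_sum_superset[OF p(1) Ac Bc] by (simp add: C_def)
  have "measure lebesgue A > 0" using False by (simp add: less_le)
  then obtain r where r: "r > 0" "\<And>x. r * norm x \<le> support_fun A x"
    using support_fun_ge_norm[OF Ac(1) lp_zonoid_support_fun_minus[OF A p(1)]] by blast
  obtain Y where Y: "\<And>n. lp_zonotope p (Y n)" "(\<lambda>n. hausdorff_dist (Y n) A) \<longlonglongrightarrow> 0"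
    using A unfolding lp_zonoid_def by blast
  obtain Z where Z: "\<And>n. lp_zonotope p (Z n)" "(\<lambda>n. hausdorff_dist (Z n) B) \<longlonglongrightarrow> 0"
    using B unfolding lp_zonoid_def by blast
  have Yc: "convex_body (Y n)" "0 \<in> Y n" for n using lp_zonotope_convex_body[OF Y(1) p(1)] by auto
  have Zc: "convex_body (Z n)" "0 \<in> Z n" for n using lp_zonotope_convex_body[OF Z(1) p(1)] by auto
  define d where "d n = hausdorff_dist (Y n) A" for n
  define e where "e n = hausdorff_dist (Z n) B" for n
  have d0: "d n \<ge> 0" for n
    using infdist_le_hausdorff_dist[of "Y n" 0 A] Yc infdist_nonneg[of 0 A]
    by (force simp: d_def convex_body_def)
  have e0: "e n \<ge> 0" for n
    using infdist_le_hausdorff_dist[of "Z n" 0 B] Zc infdist_nonneg[of 0 B]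
    by (force simp: e_def convex_body_def)
  define t where "t n = 1 - d n / r" for n
  define s where "s n = 1 + (d n + e n) / r" for n
  define X where "X n = lp_sum p (Y n) (Z n)" for n
  have Xc: "convex_body (X n)" "0 \<in> X n" for n
    unfolding X_def using lp_sum_props(1,2)[OF p(1) Yc Zc] .
  have lower: "t n * support_fun A x \<le> 1 * support_fun (Y n) x" for n x
  proof -
    have "support_fun A x \<le> support_fun (Y n) x + d n * norm x"
      using support_fun_le_hausdorff[OF Ac(1) Yc(1)] by (simp add: d_def hausdorff_dist_commute)
    moreover have "d n / r * (r * norm x) \<le> d n / r * support_fun A x"
      using r d0 by (intro mult_left_mono) auto
    ultimately show ?thesis using r by (simp add: t_def left_diff_distrib)
  qed
  have upper: "1 * support_fun (X n) x \<le> s n * support_fun C x" for n x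
  proof -
    have "support_fun (X n) x \<le> support_fun C x + (d n * norm x + e n * norm x)"
      unfolding X_def C_def support_fun_lp_sum[OF p(1) Yc Zc] support_fun_lp_sum[OF p(1) Ac Bc]
      using p Ac Bc Yc Zc d0 e0 support_fun_le_hausdorff[OF Yc(1) Ac(1)] support_fun_le_hausdorff[OF Zc(1) Bc(1)]
      by (intro lp_norm_add_le) (auto simp: support_fun_nonneg d_def e_def)
    moreover have "(d n + e n) / r * (r * norm x) \<le> (d n + e n) / r * support_fun C x"
      using r d0 e0 hAC[of x] by (intro mult_left_mono) (auto intro: order_trans)
    moreover have "(d n + e n) / r * (r * norm x) = d n * norm x + e n * norm x"
      using r(1) by (simp add: field_simps)
    moreover have "s n * support_fun C x = support_fun C x + (d n + e n) / r * support_fun C x"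
      by (simp add: s_def distrib_right)
    ultimately show ?thesis by linarith
  qed
  have limY: "(\<lambda>n. support_fun (Y n) w) \<longlonglongrightarrow> support_fun A w"
    by (rule support_fun_tendsto[OF Ac(1) Yc(1) Y(2)])
  have limZ: "(\<lambda>n. support_fun (Z n) w) \<longlonglongrightarrow> support_fun B w"
    by (rule support_fun_tendsto[OF Bc(1) Zc(1) Z(2)])
  have limX: "(\<lambda>n. support_fun (X n) w) \<longlonglongrightarrow> support_fun C w"
    unfolding X_def C_def support_fun_lp_sum[OF p(1) Yc Zc] support_fun_lp_sum[OF p(1) Ac Bc]
    using limY limZ p m Ac Bc Yc Zc
    by (intro tendsto_powr' tendsto_intros) (auto simp: support_fun_nonneg add_nonneg_nonneg)
  have limd: "d \<longlonglongrightarrow> 0" "e \<longlonglongrightarrow> 0" using Y(2) Z(2) by (simp_all add: d_def[abs_def] e_def[abs_def])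
  have limt: "t \<longlonglongrightarrow> 1"
    unfolding t_def[abs_def] by (rule tendsto_eq_intros limd | use r in simp)+
  have lims: "s \<longlonglongrightarrow> 1"
    unfolding s_def[abs_def] by (rule tendsto_eq_intros limd | use r in simp)+
  have "measure lebesgue A * support_fun C w \<le> measure lebesgue C * support_fun A w"
  proof (rule tendsto_le[OF trivial_limit_sequentially])
    show "(\<lambda>n. (t n)\<^sup>2 * measure lebesgue A * support_fun (X n) w) \<longlonglongrightarrow> measure lebesgue A * support_fun C w"
      by (rule tendsto_eq_intros limt limX | simp)+
    show "(\<lambda>n. (s n)\<^sup>2 * measure lebesgue C * support_fun (Y n) w) \<longlonglongrightarrow> measure lebesgue C * support_fun A w"
      by (rule tendsto_eq_intros lims limY | simp)+
    have "\<forall>\<^sub>F n in sequentially. t n > 0" using order_tendstoD(1)[OF limt] by simp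
    moreover have "\<forall>\<^sub>F n in sequentially. support_fun (Y n) w > 0" using order_tendstoD(1)[OF limY m] .
    ultimately show "\<forall>\<^sub>F n in sequentially. (t n)\<^sup>2 * measure lebesgue A * support_fun (X n) w
        \<le> (s n)\<^sup>2 * measure lebesgue C * support_fun (Y n) w"
    proof eventually_elim
      case (elim n)
      have "(t n)\<^sup>2 * measure lebesgue A * support_fun (X n) w \<le> measure lebesgue (Y n) * support_fun (X n) w"
        using area_le_if_support_fun_le[OF Ac(1) Yc(1), of "t n" 1] lower elim support_fun_nonneg[OF Xc]
        by (intro mult_right_mono) auto
      also have "\<dots> \<le> measure lebesgue (X n) * support_fun (Y n) w"
        unfolding X_def by (rule lp_zonotope_ratio_mono[OF p Y(1) Z(1) elim(2)])
      also have "\<dots> \<le> (s n)\<^sup>2 * measure lebesgue C * support_fun (Y n) w"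
        using area_le_if_support_fun_le[OF Xc(1) Cc(1), of 1 "s n"] upper elim d0 e0 r
        by (intro mult_right_mono) (auto simp: s_def)
      finally show ?case .
    qed
  qed
  then show ?thesis by (simp add: C_def)
qed

section \<open>The ratio of area to projection length\<close>

theorem theorem2:
  fixes p :: real and A B :: "(real^2) set" and u :: "real^2"
  assumes "1 \<le> p" and "p \<le> 2"
    and "lp_zonoid p A" and "lp_zonoid p B"
    and "norm u = 1"
    and "perp_line_length u (proj_perp u ` A) > 0"
  shows "measure lebesgue (lp_sum p A B) / perp_line_length u (proj_perp u ` lp_sum p A B)
           \<ge> measure lebesgue A / perp_line_length u (proj_perp u ` A)"
proof -
  note p = assms(1,2) and A = assms(3) and B = assms(4) and u = assms(5)
  note Ac = lp_zonoid_convex_body[OF A p(1)] and Bc = lp_zonoid_convex_body[OF B p(1)]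
  define w where "w = rot90 u"
  have lenA: "perp_line_length u (proj_perp u ` A) = 2 * support_fun A w"
    using perp_line_length_proj[OF u Ac(1)] lp_zonoid_support_fun_minus[OF A p(1)] by (simp add: w_def)
  have lenC: "perp_line_length u (proj_perp u ` lp_sum p A B) = 2 * support_fun (lp_sum p A B) w"
    using perp_line_length_proj[OF u lp_sum_props(1)[OF p(1) Ac Bc]]
      lp_zonoid_support_fun_minus[OF A p(1)] lp_zonoid_support_fun_minus[OF B p(1)]
    by (simp add: w_def support_fun_lp_sum[OF p(1) Ac Bc])
  have m: "support_fun A w > 0" using assms(6) by (simp add: lenA)
  have "support_fun A w \<le> support_fun (lp_sum p A B) w"
    using lp_sum_superset[OF p(1) Ac Bc] by (intro support_fun_mono Ac lp_sum_props(1)[OF p(1) Ac Bc])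
  with m have "support_fun (lp_sum p A B) w > 0" by linarith
  then show ?thesis
    using lp_zonoid_ratio_mono[OF p A B m] m by (simp add: lenA lenC field_simps)
qed

end
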